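(* Let $k \geq 2$ be an integer. Then: (i) for every $t \in (0,1)$ there is a constant $c = c(k,t) \in (0,1)$ such that $\vartheta(S^{n-1},k,t) \leq (c+o(1))^n$ as $n \to \infty$ (over $n \geq k$); (ii) there is a constant $c = c(k) \in (0,1)$ such that $\vartheta(\mathbb{R}^n,k) \leq (c+o(1))^n$ as $n \to \infty$. Here "$a_n \leq (c+o(1))^n$" means there is a sequence $\varepsilon_n \to 0$ with $a_n \leq (c+\varepsilon_n)^n$ for all large $n$.
   Context: $S^{n-1}=\{x\in\mathbb{R}^n:\|x\|=1\}$ and $\omega$ is the surface measure on $S^{n-1}$ normalized to total measure $1$. A continuous function $f\colon[-1,1]\to\mathbb{R}$ is of positive type for $S^{n-1}$ if for every finite $U\subseteq S^{n-1}$ the matrix $(f(x\cdot y))_{x,y\in U}$ is positive semidefinite. Sphere parameters (defined recursively): for $n\geq 2$ and $t\in[-1,1)$, $\vartheta(S^{n-1},2,t)$ is the supremum of $\int_{S^{n-1}}\int_{S^{n-1}} f(x\cdot y)\,d\omega(y)\,d\omega(x)$ over all continuous $f\colon[-1,1]\to\mathbb{R}$ of positive type for $S^{n-1}$ with $f(1)=1$ and $f(t)=0$. For $n\geq k\geq 3$ and $t\in[-1/(k-1),1)$, $\vartheta(S^{n-1},k,t)$ is the supremum of the same integral over all continuous $f$ of positive type for $S^{n-1}$ with $f(1)=1$ and $f(t)\leq \vartheta(S^{n-2},k-1,t/(1+t))$. Euclidean parameters: a continuous $f\colon\mathbb{R}^n\to\mathbb{R}$ is of positive type if $(f(x-y))_{x,y\in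 U}$ is positive semidefinite for every finite $U\subseteq\mathbb{R}^n$; such $f$ has mean value $M(f)=\lim_{T\to\infty}\frac{1}{\operatorname{vol}[-T,T]^n}\int_{[-T,T]^n}f(x)\,dx$. $f$ is radial if $f(x)$ depends only on $\|x\|$, and then $f(r)$ denotes its value at vectors of norm $r$. For $n\geq 2$ and $3\leq k\leq n+1$, $\vartheta(\mathbb{R}^n,k)$ is the supremum of $M(f)$ over continuous radial functions $f\colon\mathbb{R}^n\to\mathbb{R}$ of positive type with $f(0)=1$ and $f(1)\leq \vartheta(S^{n-1},k-1,1/2)$; and $\vartheta(\mathbb{R}^n,2)$ is the supremum of $M(f)$ over such $f$ with $f(0)=1$ and $f(1)=0$. *)

theory Defs
  imports "HOL-Analysis.Analysis"
begin

text \<open>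
  The dimension n has to vary inside the statement, so \<open>\<real>\<^sup>n\<close> is the set of functions
  \<open>nat \<Rightarrow> real\<close> that are extensional on \<open>{..<n}\<close>; this is also the space of the
  library's product measure. Its Euclidean norm is \<^const>\<open>L2_set\<close>, and its topology is the one
  induced from the product topology on \<open>nat \<Rightarrow> real\<close>.
\<close>

definition Rn :: "nat \<Rightarrow> (nat \<Rightarrow> real) set" where
  "Rn n = (\<Pi>\<^sub>E i\<in>{..<n}. UNIV)"

definition Rn_lebesgue :: "nat \<Rightarrow> (nat \<Rightarrow> real) measure" where
  "Rn_lebesgue n = (\<Pi>\<^sub>M i\<in>{..<n}. lborel)"

definition Rn_norm :: "nat \<Rightarrow> (nat \<Rightarrow> real) \<Rightarrow> real" where
  "Rn_norm n x = L2_set x {..<n}"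

definition Rn_inner :: "nat \<Rightarrow> (nat \<Rightarrow> real) \<Rightarrow> (nat \<Rightarrow> real) \<Rightarrow> real" where
  "Rn_inner n x y = (\<Sum>i<n. x i * y i)"

definition Rn_diff :: "nat \<Rightarrow> (nat \<Rightarrow> real) \<Rightarrow> (nat \<Rightarrow> real) \<Rightarrow> (nat \<Rightarrow> real)" where
  "Rn_diff n x y = (\<lambda>i\<in>{..<n}. x i - y i)"

definition Rn_zero :: "nat \<Rightarrow> (nat \<Rightarrow> real)" where
  "Rn_zero n = (\<lambda>i\<in>{..<n}. 0)"

text \<open>The unit sphere of \<open>\<real>\<^sup>n\<close>, that is, \<open>S\<^bsup>n-1\<^esup>\<close>.\<close>

definition Rn_sphere :: "nat \<Rightarrow> (nat \<Rightarrow> real) set" where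
  "Rn_sphere n = {x \<in> Rn n. Rn_norm n x = 1}"

text \<open>
  The normalized surface measure on \<open>S\<^bsup>n-1\<^esup>\<close>, obtained from Lebesgue measure through polar
  coordinates: the measure of A is the volume of the cone \<open>{r a | 0 < r \<le> 1, a \<in> A}\<close>
  divided by the volume of the unit ball. The underlying space is the sphere itself (not
  \<open>\<real>\<^sup>n\<close>), so that integrands need to be measurable only there.
\<close>

definition sphere_measure :: "nat \<Rightarrow> (nat \<Rightarrow> real) measure" where
  "sphere_measure n =
     distr
       (restrict_space
         (uniform_measure (Rn_lebesgue n) {x \<in> Rn n. 0 < Rn_norm n x \<and> Rn_norm n x \<le> 1})
         {x \<in> Rn n. 0 < Rn_norm n x \<and> Rn_norm n x \<le> 1})
       (restrict_space (Rn_lebesgue n) (Rn_sphere n))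
       (\<lambda>x. \<lambda>i\<in>{..<n}. x i / Rn_norm n x)"

definition psd_on :: "'a set \<Rightarrow> ('a \<Rightarrow> 'a \<Rightarrow> real) \<Rightarrow> bool" where
  "psd_on U A \<longleftrightarrow>
     (\<forall>x\<in>U. \<forall>y\<in>U. A x y = A y x) \<and>
     (\<forall>c :: 'a \<Rightarrow> real. 0 \<le> (\<Sum>x\<in>U. \<Sum>y\<in>U. c x * A x y * c y))"

definition sphere_positive_type :: "nat \<Rightarrow> (real \<Rightarrow> real) \<Rightarrow> bool" where
  "sphere_positive_type n f \<longleftrightarrow>
     (\<forall>U. finite U \<and> U \<subseteq> Rn_sphere n \<longrightarrow> psd_on U (\<lambda>x y. f (Rn_inner n x y)))"

definition sphere_integral :: "nat \<Rightarrow> (real \<Rightarrow> real) \<Rightarrow> real" where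
  "sphere_integral n f =
     (\<integral>x. (\<integral>y. f (Rn_inner n x y) \<partial>sphere_measure n) \<partial>sphere_measure n)"

text \<open>
  \<open>theta_sphere n k t\<close> is \<open>\<vartheta>(S\<^bsup>n-1\<^esup>, k, t)\<close>, meaningful for \<open>n \<ge> k \<ge> 2\<close> and
  \<open>-1/(k-1) \<le> t < 1\<close>; n is the dimension of the ambient space. A function on \<open>[-1,1]\<close> is
  represented by any extension to the reals. The suprema are taken in the extended reals, so
  that they are genuine suprema without boundedness or nonemptiness conditions.
\<close>

fun theta_sphere :: "nat \<Rightarrow> nat \<Rightarrow> real \<Rightarrow> ereal" where
  "theta_sphere n (Suc (Suc 0)) t =
     (SUP f \<in> {f. continuous_on {-1..1} f \<and> sphere_positive_type n f \<and> f 1 = 1 \<and> f t = 0}.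
        ereal (sphere_integral n f))"
| "theta_sphere n (Suc (Suc (Suc k))) t =
     (SUP f \<in> {f. continuous_on {-1..1} f \<and> sphere_positive_type n f \<and> f 1 = 1 \<and>
                  ereal (f t) \<le> theta_sphere (n - 1) (Suc (Suc k)) (t / (1 + t))}.
        ereal (sphere_integral n f))"

definition Rn_positive_type :: "nat \<Rightarrow> ((nat \<Rightarrow> real) \<Rightarrow> real) \<Rightarrow> bool" where
  "Rn_positive_type n f \<longleftrightarrow>
     (\<forall>U. finite U \<and> U \<subseteq> Rn n \<longrightarrow> psd_on U (\<lambda>x y. f (Rn_diff n x y)))"

definition Rn_radial :: "nat \<Rightarrow> ((nat \<Rightarrow> real) \<Rightarrow> real) \<Rightarrow> bool" where
  "Rn_radial n f \<longleftrightarrow> (\<forall>x\<in>Rn n. \<forall>y\<in>Rn n. Rn_norm n x = Rn_norm n y \<longrightarrow> f x = f y)"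

definition mean_value :: "nat \<Rightarrow> ((nat \<Rightarrow> real) \<Rightarrow> real) \<Rightarrow> real" where
  "mean_value n f =
     Lim at_top (\<lambda>T::real.
       1 / measure (Rn_lebesgue n) (\<Pi>\<^sub>E i\<in>{..<n}. {-T..T}) *
       (LINT x : (\<Pi>\<^sub>E i\<in>{..<n}. {-T..T}) | Rn_lebesgue n. f x))"

text \<open>
  \<open>theta_Rn n k\<close> is \<open>\<vartheta>(\<real>\<^sup>n, k)\<close>, meaningful for \<open>n \<ge> 2\<close> and \<open>2 \<le> k \<le> n + 1\<close>. The value
  \<open>f(1)\<close> of a radial f is its value at the points of the unit sphere.
\<close>

definition theta_Rn :: "nat \<Rightarrow> nat \<Rightarrow> ereal" where
  "theta_Rn n k =
     (SUP f \<in> {f. continuous_on (Rn n) f \<and> Rn_radial n f \<and> Rn_positive_type n f \<and>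
                  f (Rn_zero n) = 1 \<and>
                  (\<forall>x \<in> Rn_sphere n.
                     if k = 2 then f x = 0 else ereal (f x) \<le> theta_sphere n (k - 1) (1 / 2))}.
        ereal (mean_value n f))"

text \<open>The relation \<open>a\<^sub>n \<le> (c + o(1))\<^sup>n\<close>.\<close>

definition exp_bound :: "(nat \<Rightarrow> ereal) \<Rightarrow> real \<Rightarrow> bool" where
  "exp_bound a c \<longleftrightarrow>
     (\<exists>\<epsilon> :: nat \<Rightarrow> real. \<epsilon> \<longlonglongrightarrow> 0 \<and>
        (\<forall>\<^sub>F n in sequentially. a n \<le> ereal ((c + \<epsilon> n) ^ n)))"

end

theory Submission
  imports Defs
begin

text \<open>
  For a normalized kernel of positive type, let \<open>mu\<close> be the infimum of its quadratic form over affine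
  combinations of points; subtracting \<open>mu\<close> leaves the kernel positive semidefinite. A nearly minimal
  combination \<open>w\<close> satisfies \<open>(\<Sum>x. w x * A x y) \<approx> mu\<close> uniformly in \<open>y\<close>, so averaging over \<open>y\<close> identifies
  \<open>mu\<close> with the double integral on the sphere (where the average of \<open>f (x \<bullet> y)\<close> over \<open>y\<close> does not depend
  on \<open>x\<close>, by rotation invariance) and with the mean value on Euclidean space, whose existence is obtained
  on the way.

  It then suffices to find a finite configuration for which the graph joining points at the prescribed inner
  product or distance is regular of degree \<open>D\<close> and has least eigenvalue at least \<open>- q\<^sup>n * D\<close> for some
  \<open>q < 1\<close>. A copy of the discrete cube of dimension \<open>m\<close>, with edges at an even
  Hamming distance \<open>d = m * (1 - 1/L) / 2\<close>, does this. Its eigenvalues are Krawtchouk values: the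
  three-term recurrence shows them to be positive for small index and exponentially small compared with the degree
  otherwise. On the sphere the fixed extra coordinate \<open>sqrt (1 - r)\<close>, with the cube scaled to radius
  \<open>sqrt r\<close>, turns the inner product \<open>1/L\<close> of adjacent cube points into the given \<open>t \<ge> 1/L\<close>. So passing
  from \<open>k - 1\<close> to \<open>k\<close> adds only an exponentially small term to the bound.
\<close>

section \<open>Affine minimum of a positive semidefinite kernel\<close>

text \<open>The two vectors are kept apart because expanding the form at a combination of two
  vectors produces mixed terms.\<close>

definition kernel_form :: "'a set \<Rightarrow> ('a \<Rightarrow> 'a \<Rightarrow> real) \<Rightarrow> ('a \<Rightarrow> real) \<Rightarrow> ('a \<Rightarrow> real) \<Rightarrow> real" where
  "kernel_form U A c d = (\<Sum>x\<in>U. \<Sum>y\<in>U. c x * A x y * d y)"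

lemma kernel_form_add_left:
  "kernel_form U A (\<lambda>x. a * c x + b * c' x) d = a * kernel_form U A c d + b * kernel_form U A c' d"
  unfolding kernel_form_def
  by (simp add: sum.distrib sum_distrib_left algebra_simps)

lemma kernel_form_add_right:
  "kernel_form U A d (\<lambda>x. a * c x + b * c' x) = a * kernel_form U A d c + b * kernel_form U A d c'"
  unfolding kernel_form_def
  by (simp add: sum.distrib sum_distrib_left algebra_simps)

lemma kernel_form_mono_neutral:
  assumes "finite V" "U \<subseteq> V" "\<And>x. x \<in> V - U \<Longrightarrow> c x = 0"
  shows "kernel_form V A c c = kernel_form U A c c"
proof -
  have "kernel_form V A c c = (\<Sum>x\<in>U. \<Sum>y\<in>V. c x * A x y * c y)"
    unfolding kernel_form_def using assms by (intro sum.mono_neutral_right) auto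
  also have "\<dots> = kernel_form U A c c"
    unfolding kernel_form_def using assms by (intro sum.cong sum.mono_neutral_right) auto
  finally show ?thesis .
qed

lemma kernel_form_sym:
  assumes "\<And>x y. x \<in> U \<Longrightarrow> y \<in> U \<Longrightarrow> A x y = A y x"
  shows "kernel_form U A c d = kernel_form U A d c"
  unfolding kernel_form_def
  by (subst sum.swap) (auto intro!: sum.cong simp: assms)

text \<open>A common setting for the kernels \<open>f (Rn_inner n x y)\<close> on the sphere and
  \<open>f (Rn_diff n x y)\<close> on \<open>Rn n\<close>; the normalization of \<open>f\<close>
  makes the diagonal 1 in both cases.\<close>

locale psd_kernel =
  fixes X :: "'a set" and A :: "'a \<Rightarrow> 'a \<Rightarrow> real"
  assumes psd: "\<And>U. finite U \<Longrightarrow> U \<subseteq> X \<Longrightarrow> psd_on U A"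
    and diag: "\<And>x. x \<in> X \<Longrightarrow> A x x = 1"
    and nonempty: "X \<noteq> {}"
begin

lemma sym: "x \<in> X \<Longrightarrow> y \<in> X \<Longrightarrow> A x y = A y x"
  using psd[of "{x,y}"] unfolding psd_on_def by blast

lemma form_nonneg: "finite U \<Longrightarrow> U \<subseteq> X \<Longrightarrow> 0 \<le> kernel_form U A c c"
  using psd[of U] unfolding psd_on_def kernel_form_def by blast

lemma abs_le_1:
  assumes "x \<in> X" "y \<in> X"
  shows "\<bar>A x y\<bar> \<le> 1"
proof (cases "x = y")
  case True
  then show ?thesis using diag assms by simp
next
  case False
  \<comment> \<open>The vectors (1, 1) and (1, -1) give the values \<open>2 + 2 * A x y\<close> and
    \<open>2 - 2 * A x y\<close>.\<close>
  have "0 \<le> kernel_form {x,y} A (\<lambda>z. 1) (\<lambda>z. 1)" "0 \<le> kernel_form {x,y} A (\<lambda>z. if z = x then 1 else -1) (\<lambda>z. if z = x then 1 else -1)"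
    using form_nonneg assms by auto
  then show ?thesis using False diag assms sym[OF assms]
    by (auto simp: kernel_form_def)
qed

definition affine_values :: "real set" where
  "affine_values = {kernel_form U A w w | U w. finite U \<and> U \<subseteq> X \<and> sum w U = 1}"

text \<open>With the kernel read as a Gram matrix of feature vectors, this is the squared distance
  from the origin to their affine hull.\<close>

definition mu :: real where "mu = Inf affine_values"

lemma affine_values_nonempty: "affine_values \<noteq> {}"
proof -
  obtain x where "x \<in> X" using nonempty by blast
  then have "kernel_form {x} A (\<lambda>_. 1) (\<lambda>_. 1) \<in> affine_values"
    unfolding affine_values_def by (intro CollectI exI[of _ "{x}"] exI[of _ "\<lambda>_. 1"]) auto
  then show ?thesis by blast
qed

lemma affine_values_bdd: "bdd_below affine_values"
  unfolding affine_values_def bdd_below_def using form_nonneg by auto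

lemma mu_nonneg: "0 \<le> mu"
  unfolding mu_def using affine_values_nonempty
  by (intro cInf_greatest) (auto simp: affine_values_def form_nonneg)

lemma mu_le: "finite U \<Longrightarrow> U \<subseteq> X \<Longrightarrow> sum w U = 1 \<Longrightarrow> mu \<le> kernel_form U A w w"
  unfolding mu_def by (intro cInf_lower affine_values_bdd) (auto simp: affine_values_def)

lemma mu_le_1: "mu \<le> 1"
proof -
  obtain x where "x \<in> X" using nonempty by blast
  then show ?thesis using mu_le[of "{x}" "\<lambda>_. 1"] diag by (auto simp: kernel_form_def)
qed

text \<open>Scaling \<open>c\<close> to total weight 1 reduces the claim to \<open>mu_le\<close>. As
  \<open>(sum c U)\<^sup>2\<close> is the form of the all-ones kernel, the kernel stays positive
  semidefinite after \<open>mu\<close> is subtracted from every entry.\<close>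

lemma form_ge_mu:
  assumes "finite U" "U \<subseteq> X"
  shows "mu * (sum c U)\<^sup>2 \<le> kernel_form U A c c"
proof (cases "sum c U = 0")
  case True
  then show ?thesis using form_nonneg assms by simp
next
  case False
  let ?s = "sum c U"
  have "mu \<le> kernel_form U A (\<lambda>x. c x / ?s) (\<lambda>x. c x / ?s)"
    using False by (intro mu_le assms) (simp add: sum_divide_distrib[symmetric])
  also have "\<dots> = kernel_form U A c c / ?s\<^sup>2"
    unfolding kernel_form_def by (simp add: sum_divide_distrib power2_eq_square)
  finally show ?thesis using False by (simp add: field_simps)
qed

text \<open>A family may repeat points, so the coefficients of all indices with the same image are
  first collected into \<open>C\<close>; then the bound for sets of points applies.\<close>

lemma family_form_ge_mu:
  assumes "finite J" "v ` J \<subseteq> X"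
  shows "mu * (sum c J)\<^sup>2 \<le> (\<Sum>i\<in>J. \<Sum>j\<in>J. c i * A (v i) (v j) * c j)"
proof -
  define C where "C z = (\<Sum>i\<in>{i\<in>J. v i = z}. c i)" for z
  have 1: "sum C (v ` J) = sum c J"
    unfolding C_def using sum.image_gen[OF assms(1), of c v] by simp
  have 2: "(\<Sum>j\<in>J. a z * A z (v j) * c j) = (\<Sum>y\<in>v ` J. a z * A z y * C y)" for a z
    unfolding C_def
    by (subst sum.image_gen[OF assms(1), of _ v]) (auto intro!: sum.cong simp: sum_distrib_left)
  have "(\<Sum>i\<in>J. \<Sum>j\<in>J. c i * A (v i) (v j) * c j) = (\<Sum>i\<in>J. c i * (\<Sum>y\<in>v ` J. A (v i) y * C y))"
    using 2[of "\<lambda>_. 1"] by (simp add: sum_distrib_left[symmetric] mult.assoc)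
  also have "\<dots> = (\<Sum>x\<in>v ` J. C x * (\<Sum>y\<in>v ` J. A x y * C y))"
    unfolding C_def
    by (subst sum.image_gen[OF assms(1), of _ v]) (auto intro!: sum.cong simp: sum_distrib_right)
  also have "\<dots> = kernel_form (v ` J) A C C"
    by (simp add: kernel_form_def sum_distrib_left mult.assoc)
  finally show ?thesis using form_ge_mu[of "v ` J" C] assms 1 by simp
qed

text \<open>
  A nearly minimal affine combination of the feature vectors of the kernel is nearly orthogonal to
  all differences of feature vectors; here the squared distance to the infimum is \<open>s\<^sup>2\<close>.
\<close>
lemma near_minimizer:
  assumes s: "0 < s" "s \<le> 1"
  obtains U w where "finite U" "U \<subseteq> X" "sum w U = 1"
    "\<And>y. y \<in> X \<Longrightarrow> \<bar>(\<Sum>x\<in>U. w x * A x y) - mu\<bar> \<le> 5 * s"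
proof -
  have "Inf affine_values < mu + s\<^sup>2" using s by (simp add: mu_def)
  then obtain v where "v \<in> affine_values" "v < mu + s\<^sup>2"
    using cInf_lessD[OF affine_values_nonempty] by blast
  then obtain U w0 where U: "finite U" "U \<subseteq> X" "sum w0 U = 1" "kernel_form U A w0 w0 < mu + s\<^sup>2"
    unfolding affine_values_def by auto
  \<comment> \<open>Zero outside \<open>U\<close>, so that \<open>w\<close> can also be used on
    \<open>V\<close>, where the point \<open>y\<close> is adjoined.\<close>
  define w where "w x = (if x \<in> U then w0 x else 0)" for x
  have w1: "sum w U = 1" using U unfolding w_def by simp
  define p where "p = kernel_form U A w w"
  have p: "p < mu + s\<^sup>2" "mu \<le> p"
    using U mu_le[of U w] w1 unfolding p_def by (auto simp: kernel_form_def w_def)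
  have "\<bar>(\<Sum>x\<in>U. w x * A x y) - mu\<bar> \<le> 5 * s" if y: "y \<in> X" for y
  proof -
    define b where "b = (\<Sum>x\<in>U. w x * A x y)"
    define V where "V = insert y U"
    define e where "e x = (if x = y then 1 else 0 :: real)" for x
    have V: "finite V" "V \<subseteq> X" "U \<subseteq> V" "y \<in> V" using U y unfolding V_def by auto
    have pV: "kernel_form V A w w = p"
      unfolding p_def using V by (intro kernel_form_mono_neutral) (auto simp: w_def)
    have we: "kernel_form V A w e = b"
    proof -
      have "kernel_form V A w e = (\<Sum>x\<in>V. w x * A x y)"
        unfolding kernel_form_def e_def using V by (intro sum.cong) (auto simp: if_distrib[of "\<lambda>z. _ * z"] cong: if_cong)
      also have "\<dots> = b" unfolding b_def using V by (intro sum.mono_neutral_right) (auto simp: w_def)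
      finally show ?thesis .
    qed
    have ew: "kernel_form V A e w = b"
      using kernel_form_sym[of V A] V sym we by (metis subsetD)
    have ee: "kernel_form V A e e = 1"
    proof -
      have "kernel_form V A e e = (\<Sum>x\<in>V. e x * A x y)"
        unfolding kernel_form_def e_def using V by (intro sum.cong) (auto simp: if_distrib[of "\<lambda>z. _ * z"] cong: if_cong)
      also have "\<dots> = (\<Sum>x\<in>V. if x = y then A x y else 0)"
        by (intro sum.cong) (auto simp: e_def)
      also have "\<dots> = 1" using V diag y by simp
      finally show ?thesis .
    qed
    have sV: "sum w V = 1" "sum e V = 1"
    proof -
      have "sum w V = sum w U" using V by (intro sum.mono_neutral_right) (auto simp: w_def)
      then show "sum w V = 1" using w1 by simp
      show "sum e V = 1" using V unfolding e_def by simp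
    qed
    have comb: "kernel_form V A (\<lambda>x. a * w x + r * e x) (\<lambda>x. a * w x + r * e x)
        = a\<^sup>2 * p + 2 * a * r * b + r\<^sup>2" for a r
      by (simp add: kernel_form_add_left kernel_form_add_right pV we ew ee power2_eq_square algebra_simps)
    have q: "mu \<le> (1-r)\<^sup>2 * p + 2 * (1-r) * r * b + r\<^sup>2" for r
      using mu_le[OF V(1,2), of "\<lambda>x. (1-r) * w x + r * e x"] sV
      by (simp add: sum.distrib sum_distrib_left[symmetric] comb)
    have pos: "0 \<le> a\<^sup>2 * p + 2 * a * r * b + r\<^sup>2" for a r
      using form_nonneg[OF V(1,2), of "\<lambda>x. a * w x + r * e x"] by (simp add: comb)
    have s2: "s\<^sup>2 \<le> s" "0 \<le> s\<^sup>2" using s by (auto simp: power2_eq_square mult_le_cancel_left1)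
    have p2: "p \<le> 2" using p mu_le_1 s s2 by linarith
    have b2: "\<bar>b\<bar> \<le> 2" using pos[of 1 1] pos[of 1 "-1"] p2 by simp
    have D: "p - 2 * b + 1 \<le> 7" using p2 b2 by linarith
    \<comment> \<open>Moving from \<open>w\<close> towards the point mass \<open>e\<close> keeps the
      total weight 1, so the form stays above \<open>mu > p - s\<^sup>2\<close>. This gives a
      quadratic in \<open>r\<close> with constant term \<open>s\<^sup>2\<close>, linear coefficient
      \<open>2 * (b - p)\<close> and, by \<open>D\<close>, leading coefficient at most 7.\<close>
    have "0 \<le> s\<^sup>2 + 2 * r * (b - p) + r\<^sup>2 * 7" for r
    proof -
      have "(1-r)\<^sup>2 * p + 2 * (1-r) * r * b + r\<^sup>2 = p + 2 * r * (b-p) + r\<^sup>2 * (p - 2*b + 1)"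
        by (simp add: power2_eq_square algebra_simps)
      moreover have "r\<^sup>2 * (p - 2*b+1) \<le> r\<^sup>2 * 7" using D by (intro mult_left_mono) auto
      ultimately show ?thesis using q[of r] p by linarith
    qed
    \<comment> \<open>At \<open>r = s\<close> and \<open>r = -s\<close> the other two terms add up
      to \<open>8 * s\<^sup>2\<close>, which forces \<open>\<bar>b - p\<bar> \<le> 4 * s\<close>;
      the gap between \<open>p\<close> and \<open>mu\<close> costs one more
      \<open>s\<close>.\<close>
    from this[of s] this[of "-s"]
    have "0 \<le> s * (8 * s + 2 * (b - p))" "0 \<le> s * (8 * s - 2 * (b - p))"
      by (simp_all add: power2_eq_square algebra_simps)
    then have "\<bar>b - p\<bar> \<le> 4 * s" using s by (simp add: zero_le_mult_iff)
    then show ?thesis using p s2 unfolding b_def[symmetric] by linarith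
  qed
  then show ?thesis using that U w1 by blast
qed

end

section \<open>Rotation invariance of the surface measure\<close>

lemma space_Rn_lebesgue [simp]: "space (Rn_lebesgue n) = Rn n"
  by (simp add: Rn_lebesgue_def space_PiM Rn_def)

lemma Rn_component_measurable [measurable]:
  "i < n \<Longrightarrow> (\<lambda>x. x i) \<in> borel_measurable (Rn_lebesgue n)"
  unfolding Rn_lebesgue_def by measurable

lemma Rn_measurable_componentwise:
  assumes "\<And>x. x \<in> space M \<Longrightarrow> g x \<in> Rn n" "\<And>i. i < n \<Longrightarrow> (\<lambda>x. g x i) \<in> borel_measurable M"
  shows "g \<in> measurable M (Rn_lebesgue n)"
  unfolding Rn_lebesgue_def
  by (rule measurable_PiM_single') (use assms in \<open>auto simp: Rn_def\<close>)

lemma Rn_norm_measurable [measurable]: "Rn_norm n \<in> borel_measurable (Rn_lebesgue n)"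
proof -
  have "(\<lambda>x. sqrt (\<Sum>i<n. (x i)\<^sup>2)) \<in> borel_measurable (Rn_lebesgue n)" by measurable
  then show ?thesis by (simp add: Rn_norm_def L2_set_def[abs_def] fun_eq_iff[symmetric] cong: measurable_cong)
qed

lemma Rn_inner_measurable [measurable]: "Rn_inner n x \<in> borel_measurable (Rn_lebesgue n)"
proof -
  have "(\<lambda>y. (\<Sum>i<n. x i * y i)) \<in> borel_measurable (Rn_lebesgue n)" by measurable
  then show ?thesis by (simp add: Rn_inner_def[abs_def])
qed

lemma Rn_norm_sqr: "(Rn_norm n x)\<^sup>2 = Rn_inner n x x"
  unfolding Rn_norm_def L2_set_def Rn_inner_def
  by (subst real_sqrt_pow2) (auto intro!: sum_nonneg simp: power2_eq_square)

lemma Rn_norm_nonneg: "0 \<le> Rn_norm n x"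
  by (simp add: Rn_norm_def)

lemma Rn_inner_abs_le:
  "\<bar>Rn_inner n x y\<bar> \<le> Rn_norm n x * Rn_norm n y"
  unfolding Rn_inner_def Rn_norm_def
  by (rule order_trans[OF sum_abs]) (simp add: abs_mult L2_set_mult_ineq)

definition Rn_shear :: "nat \<Rightarrow> nat \<Rightarrow> real \<Rightarrow> (nat \<Rightarrow> real) \<Rightarrow> (nat \<Rightarrow> real)" where
  "Rn_shear i j a x = x(i := x i + a * x j)"

lemma Rn_shear_in: "i < n \<Longrightarrow> x \<in> Rn n \<Longrightarrow> Rn_shear i j a x \<in> Rn n"
  by (auto simp: Rn_shear_def Rn_def PiE_def extensional_def)

lemma Rn_shear_measurable [measurable]:
  assumes "i < n" "j < n"
  shows "Rn_shear i j a \<in> measurable (Rn_lebesgue n) (Rn_lebesgue n)"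
proof (rule Rn_measurable_componentwise)
  fix k assume k: "k < n"
  show "(\<lambda>x. Rn_shear i j a x k) \<in> borel_measurable (Rn_lebesgue n)"
    using assms k by (cases "k = i") (simp_all add: Rn_shear_def)
qed (use assms Rn_shear_in in auto)

text \<open>Fubini with coordinate \<open>i\<close> innermost: once the other coordinates are fixed,
  the shear translates the line by \<open>a * x j\<close>.\<close>

lemma distr_Rn_shear:
  assumes ij: "i < n" "j < n" "i \<noteq> j"
  shows "distr (Rn_lebesgue n) (Rn_lebesgue n) (Rn_shear i j a) = Rn_lebesgue n"
proof (rule measure_eqI)
  interpret product_sigma_finite "\<lambda>_::nat. lborel :: real measure" by standard
  let ?I = "{..<n} - {i}"
  have ins: "insert i ?I = {..<n}" using ij by auto
  note [measurable] = Rn_shear_measurable[OF ij(1,2)]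
  fix A assume "A \<in> sets (distr (Rn_lebesgue n) (Rn_lebesgue n) (Rn_shear i j a))"
  then have A[measurable]: "A \<in> sets (Rn_lebesgue n)" by simp
  have split: "(\<integral>\<^sup>+x. g x \<partial>Rn_lebesgue n) = (\<integral>\<^sup>+x. (\<integral>\<^sup>+y. g (x(i := y)) \<partial>lborel) \<partial>Pi\<^sub>M ?I (\<lambda>_. lborel))"
    if "g \<in> borel_measurable (Rn_lebesgue n)" for g
    using product_nn_integral_insert[of ?I i g] that unfolding ins Rn_lebesgue_def by simp
  have "emeasure (distr (Rn_lebesgue n) (Rn_lebesgue n) (Rn_shear i j a)) A
      = (\<integral>\<^sup>+x. indicator A x \<partial>distr (Rn_lebesgue n) (Rn_lebesgue n) (Rn_shear i j a))"
    by simp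
  also have "\<dots> = (\<integral>\<^sup>+x. indicator A (Rn_shear i j a x) \<partial>Rn_lebesgue n)"
    by (rule nn_integral_distr) auto
  also have "\<dots> = (\<integral>\<^sup>+x. (\<integral>\<^sup>+y. indicator A (Rn_shear i j a (x(i := y))) \<partial>lborel) \<partial>Pi\<^sub>M ?I (\<lambda>_. lborel))"
    by (rule split) measurable
  also have "\<dots> = (\<integral>\<^sup>+x. (\<integral>\<^sup>+y. indicator A (x(i := y)) \<partial>lborel) \<partial>Pi\<^sub>M ?I (\<lambda>_. lborel))"
  proof (rule nn_integral_cong)
    fix x assume x: "x \<in> space (Pi\<^sub>M ?I (\<lambda>_. lborel :: real measure))"
    have "(\<lambda>y. x(i := y)) \<in> measurable borel (Rn_lebesgue n)"
      using x ij by (intro Rn_measurable_componentwise) (auto simp: space_PiM Rn_def PiE_def extensional_def)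
    then have m: "(\<lambda>y. indicator A (x(i := y)) :: ennreal) \<in> borel_measurable borel"
      by measurable
    show "(\<integral>\<^sup>+y. indicator A (Rn_shear i j a (x(i := y))) \<partial>lborel) = (\<integral>\<^sup>+y. indicator A (x(i := y)) \<partial>lborel)"
      using nn_integral_real_affine[OF m, of 1 "a * x j"] ij
      by (simp add: Rn_shear_def add.commute)
  qed
  also have "\<dots> = (\<integral>\<^sup>+x. indicator A x \<partial>Rn_lebesgue n)"
    by (rule split[symmetric]) measurable
  finally show "emeasure (distr (Rn_lebesgue n) (Rn_lebesgue n) (Rn_shear i j a)) A = emeasure (Rn_lebesgue n) A"
    by simp
qed simp

definition Rn_rotate :: "nat \<Rightarrow> nat \<Rightarrow> real \<Rightarrow> real \<Rightarrow> (nat \<Rightarrow> real) \<Rightarrow> (nat \<Rightarrow> real)" where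
  "Rn_rotate i j c s x = x(i := c * x i - s * x j, j := s * x i + c * x j)"

text \<open>With \<open>c\<close> and \<open>s\<close> the cosine and sine of an angle,
  \<open>(c - 1) / s\<close> is minus the tangent of half the angle: the classical factorization of
  a plane rotation into three shears. Volume preservation of rotations with
  \<open>s \<noteq> 0\<close> follows from it.\<close>

lemma Rn_rotate_eq_shears:
  assumes "i \<noteq> j" "c\<^sup>2 + s\<^sup>2 = 1" "s \<noteq> 0"
  shows "Rn_rotate i j c s = Rn_shear i j ((c - 1) / s) \<circ> (Rn_shear j i s \<circ> Rn_shear i j ((c - 1) / s))"
proof
  fix x
  have "s * ((c - 1) / s) = c - 1" using assms by simp
  moreover have "(c - 1) / s * (1 + c) = - s"
    using assms by (simp add: field_simps power2_eq_square)
  ultimately have "c * x i - s * x j = x i + (c-1)/s * x j + (c-1)/s * (x j + s * (x i + (c-1)/s * x j))"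
      "s * x i + c * x j = x j + s * (x i + (c - 1)/s * x j)"
    by algebra+
  then show "Rn_rotate i j c s x = (Rn_shear i j ((c - 1) / s) \<circ> (Rn_shear j i s \<circ> Rn_shear i j ((c - 1) / s))) x"
    using assms(1) by (auto simp: Rn_rotate_def Rn_shear_def fun_eq_iff)
qed

lemma Rn_rotate_in: "i < n \<Longrightarrow> j < n \<Longrightarrow> x \<in> Rn n \<Longrightarrow> Rn_rotate i j c s x \<in> Rn n"
  by (auto simp: Rn_rotate_def Rn_def PiE_def extensional_def)

lemma Rn_rotate_measurable:
  assumes "i < n" "j < n"
  shows "Rn_rotate i j c s \<in> measurable (Rn_lebesgue n) (Rn_lebesgue n)"
proof (rule Rn_measurable_componentwise)
  fix k assume k: "k < n"
  consider "k = j" | "k = i" "i \<noteq> j" | "k \<noteq> i" "k \<noteq> j" by blast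
  then show "(\<lambda>x. Rn_rotate i j c s x k) \<in> borel_measurable (Rn_lebesgue n)"
    using assms k by cases (simp_all add: Rn_rotate_def)
qed (use assms Rn_rotate_in in auto)

lemma distr_Rn_rotate:
  assumes ij: "i < n" "j < n" "i \<noteq> j" and cs: "c\<^sup>2 + s\<^sup>2 = 1" "s \<noteq> 0"
  shows "distr (Rn_lebesgue n) (Rn_lebesgue n) (Rn_rotate i j c s) = Rn_lebesgue n"
proof -
  let ?P = "Rn_lebesgue n"
  let ?S = "Rn_shear i j ((c - 1) / s)" and ?T = "Rn_shear j i s"
  have "distr ?P ?P (?S \<circ> (?T \<circ> ?S)) = distr (distr (distr ?P ?P ?S) ?P ?T) ?P ?S"
    using ij by (simp add: distr_distr Rn_shear_measurable measurable_comp)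
  also have "\<dots> = ?P" using ij by (simp add: distr_Rn_shear)
  finally show ?thesis using Rn_rotate_eq_shears[OF ij(3) cs] by simp
qed

lemma Rn_inner_rotate:
  assumes ij: "i < n" "j < n" "i \<noteq> j" and cs: "c\<^sup>2 + s\<^sup>2 = 1"
  shows "Rn_inner n (Rn_rotate i j c s x) (Rn_rotate i j c s y) = Rn_inner n x y"
proof -
  have split: "(\<Sum>k<n. g k) = g i + (g j + (\<Sum>k\<in>{..<n} - {i} - {j}. g k))" for g :: "nat \<Rightarrow> real"
    using ij by (simp add: sum.remove[of "{..<n}" i] sum.remove[of "{..<n} - {i}" j])
  have "(\<Sum>k\<in>{..<n} - {i} - {j}. Rn_rotate i j c s x k * Rn_rotate i j c s y k)
      = (\<Sum>k\<in>{..<n} - {i} - {j}. x k * y k)"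
    by (intro sum.cong) (auto simp: Rn_rotate_def)
  moreover have "Rn_rotate i j c s x i * Rn_rotate i j c s y i + Rn_rotate i j c s x j * Rn_rotate i j c s y j
      = x i * y i + x j * y j"
  proof -
    have "Rn_rotate i j c s x i * Rn_rotate i j c s y i + Rn_rotate i j c s x j * Rn_rotate i j c s y j
      = (c\<^sup>2 + s\<^sup>2) * (x i * y i + x j * y j)"
      using ij by (simp add: Rn_rotate_def power2_eq_square algebra_simps)
    then show ?thesis using cs by simp
  qed
  ultimately show ?thesis unfolding Rn_inner_def split by simp
qed

lemma Rn_norm_rotate:
  assumes "i < n" "j < n" "i \<noteq> j" "c\<^sup>2 + s\<^sup>2 = 1"
  shows "Rn_norm n (Rn_rotate i j c s x) = Rn_norm n x"
  using Rn_inner_rotate[OF assms, of x x] Rn_norm_nonneg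
  by (metis Rn_norm_sqr power2_eq_imp_eq)

section \<open>The normalized surface measure and the uniform measure on the ball\<close>

abbreviation punctured_ball :: "nat \<Rightarrow> (nat \<Rightarrow> real) set" where
  "punctured_ball n \<equiv> {x \<in> Rn n. 0 < Rn_norm n x \<and> Rn_norm n x \<le> 1}"

lemma punctured_ball_sets [measurable]: "punctured_ball n \<in> sets (Rn_lebesgue n)"
proof -
  have "{x \<in> space (Rn_lebesgue n). 0 < Rn_norm n x \<and> Rn_norm n x \<le> 1} \<in> sets (Rn_lebesgue n)"
    by measurable
  then show ?thesis by simp
qed

lemma Rn_sphere_sets [measurable]: "Rn_sphere n \<in> sets (Rn_lebesgue n)"
proof -
  have "{x \<in> space (Rn_lebesgue n). Rn_norm n x = 1} \<in> sets (Rn_lebesgue n)"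
    by measurable
  then show ?thesis by (simp add: Rn_sphere_def)
qed

lemma emeasure_Rn_ball:
  assumes "0 < n" "0 < r"
  shows "emeasure (Rn_lebesgue n) {x \<in> Rn n. Rn_norm n x \<le> r} = ennreal (unit_ball_vol n * r ^ n)"
proof -
  have "{x \<in> Rn n. Rn_norm n x \<le> r} = {f. sqrt (\<Sum>i\<in>{..<n}. (f i)\<^sup>2) \<le> r} \<inter> space (Pi\<^sub>M {..<n} (\<lambda>_. lborel))"
    by (auto simp: Rn_norm_def L2_set_def Rn_def space_PiM)
  then show ?thesis using emeasure_cball_aux[of "{..<n}" r] assms
    by (simp add: Rn_lebesgue_def)
qed

lemma emeasure_punctured_ball:
  assumes n: "0 < n"
  shows "emeasure (Rn_lebesgue n) (punctured_ball n) \<noteq> 0" "emeasure (Rn_lebesgue n) (punctured_ball n) \<noteq> \<infinity>"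
proof -
  let ?B = "\<lambda>r. {x \<in> Rn n. Rn_norm n x \<le> r}"
  have [measurable]: "?B r \<in> sets (Rn_lebesgue n)" for r
  proof -
    have "{x \<in> space (Rn_lebesgue n). Rn_norm n x \<le> r} \<in> sets (Rn_lebesgue n)" by measurable
    then show ?thesis by simp
  qed
  have le: "emeasure (Rn_lebesgue n) (punctured_ball n) \<le> emeasure (Rn_lebesgue n) (?B 1)"
    by (intro emeasure_mono) auto
  then show "emeasure (Rn_lebesgue n) (punctured_ball n) \<noteq> \<infinity>"
    using emeasure_Rn_ball[OF n, of 1] by (auto simp: top_unique)
  show "emeasure (Rn_lebesgue n) (punctured_ball n) \<noteq> 0"
  proof
    assume 0: "emeasure (Rn_lebesgue n) (punctured_ball n) = 0"
    \<comment> \<open>The ball of radius 1/2 covers the missing origin. If the punctured ball were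
      null, the unit ball would have at most the volume of this smaller ball, against the scaling by
      \<open>(1/2) ^ n\<close>.\<close>
    have "emeasure (Rn_lebesgue n) (?B 1) \<le> emeasure (Rn_lebesgue n) (punctured_ball n \<union> ?B (1/2))"
      by (intro emeasure_mono sets.Un) (auto simp del: le_divide_eq_numeral1)
    also have "\<dots> \<le> emeasure (Rn_lebesgue n) (punctured_ball n) + emeasure (Rn_lebesgue n) (?B (1/2))"
      by (intro emeasure_subadditive) measurable
    finally have "unit_ball_vol n \<le> unit_ball_vol n * (1/2) ^ n"
      using emeasure_Rn_ball[OF n, of 1] emeasure_Rn_ball[OF n, of "1/2"] 0
      by (simp add: ennreal_le_iff)
    moreover have "(1/2 :: real) ^ n < 1" using n by (simp add: power_less_one_iff)
    moreover have "0 < unit_ball_vol (real n)" by simp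
    ultimately have "unit_ball_vol (real n) * (1/2) ^ n < unit_ball_vol (real n) * 1"
      by (intro mult_strict_left_mono)
    then show False using \<open>unit_ball_vol n \<le> unit_ball_vol n * (1/2) ^ n\<close> by linarith
  qed
qed

definition Rn_normalize :: "nat \<Rightarrow> (nat \<Rightarrow> real) \<Rightarrow> (nat \<Rightarrow> real)" where
  "Rn_normalize n x = (\<lambda>i\<in>{..<n}. x i / Rn_norm n x)"

lemma Rn_inner_normalize: "Rn_inner n x (Rn_normalize n y) = Rn_inner n x y / Rn_norm n y"
  unfolding Rn_inner_def Rn_normalize_def sum_divide_distrib by (intro sum.cong) auto

lemma Rn_normalize_sphere:
  assumes "0 < Rn_norm n x"
  shows "Rn_normalize n x \<in> Rn_sphere n"
proof -
  have "Rn_inner n (Rn_normalize n x) (Rn_normalize n x) = Rn_inner n x x / (Rn_norm n x)\<^sup>2"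
    unfolding Rn_inner_def Rn_normalize_def sum_divide_distrib
    by (intro sum.cong) (auto simp: power2_eq_square)
  also have "\<dots> = 1" using assms by (simp add: Rn_norm_sqr[symmetric])
  finally have "(Rn_norm n (Rn_normalize n x))\<^sup>2 = 1\<^sup>2" by (simp add: Rn_norm_sqr)
  then have "Rn_norm n (Rn_normalize n x) = 1"
    using Rn_norm_nonneg by (metis power2_eq_imp_eq zero_le_one)
  then show ?thesis by (simp add: Rn_sphere_def Rn_def Rn_normalize_def)
qed

lemma Rn_normalize_measurable:
  "Rn_normalize n \<in> measurable (restrict_space (Rn_lebesgue n) (punctured_ball n))
     (restrict_space (Rn_lebesgue n) (Rn_sphere n))"
proof (rule measurable_restrict_space2)
  show "Rn_normalize n \<in> measurable (restrict_space (Rn_lebesgue n) (punctured_ball n)) (Rn_lebesgue n)"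
    by (rule measurable_restrict_space1, rule Rn_measurable_componentwise)
       (auto simp: Rn_normalize_def Rn_def)
qed (auto simp: space_restrict_space Rn_normalize_sphere)

lemma sphere_measure_eq:
  "sphere_measure n = distr (restrict_space (uniform_measure (Rn_lebesgue n) (punctured_ball n)) (punctured_ball n))
     (restrict_space (Rn_lebesgue n) (Rn_sphere n)) (Rn_normalize n)"
  unfolding sphere_measure_def Rn_normalize_def[abs_def] ..

lemma Rn_normalize_measurable_uniform:
  "Rn_normalize n \<in> measurable (restrict_space (uniform_measure (Rn_lebesgue n) (punctured_ball n)) (punctured_ball n))
     (restrict_space (Rn_lebesgue n) (Rn_sphere n))"
  using Rn_normalize_measurable
  by (subst measurable_cong_sets[OF sets_restrict_space_cong refl]) auto

lemma space_sphere_measure [simp]: "space (sphere_measure n) = Rn_sphere n"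
  by (auto simp: sphere_measure_def space_restrict_space Rn_sphere_def)

lemma sets_sphere_measure: "sets (sphere_measure n) = sets (restrict_space (Rn_lebesgue n) (Rn_sphere n))"
  by (simp add: sphere_measure_def)

lemma emeasure_space_sphere_measure:
  assumes "0 < n"
  shows "emeasure (sphere_measure n) (space (sphere_measure n)) = 1"
proof -
  let ?U = "uniform_measure (Rn_lebesgue n) (punctured_ball n)"
  have int: "punctured_ball n \<inter> Rn n = punctured_ball n" by auto
  have "emeasure (sphere_measure n) (space (sphere_measure n))
      = emeasure (restrict_space ?U (punctured_ball n)) (space (restrict_space ?U (punctured_ball n)))"
    unfolding sphere_measure_eq space_distr
    using measurable_space[OF Rn_normalize_measurable_uniform[of n]]
    by (subst emeasure_distr[OF Rn_normalize_measurable_uniform sets.top])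
       (auto intro!: arg_cong[of _ _ "emeasure _"])
  also have "\<dots> = emeasure ?U (punctured_ball n)"
    using punctured_ball_sets[of n] int
    by (subst emeasure_restrict_space) (simp_all add: space_restrict_space)
  also have "\<dots> = 1"
    using emeasure_punctured_ball[OF assms] by (intro emeasure_uniform_measure_1)
  finally show ?thesis .
qed

text \<open>Moves the integral to the uniform measure on the punctured ball, on which the rotations
  of \<open>Rn n\<close> act; the indicator takes the place of the restricted space.\<close>

lemma integral_sphere_measure:
  fixes g :: "(nat \<Rightarrow> real) \<Rightarrow> real"
  assumes [measurable]: "g \<in> borel_measurable (Rn_lebesgue n)"
  shows "(\<integral>y. g y \<partial>sphere_measure n)
    = (\<integral>y. indicator (punctured_ball n) y * g (Rn_normalize n y) \<partial>uniform_measure (Rn_lebesgue n) (punctured_ball n))"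
proof -
  let ?U = "uniform_measure (Rn_lebesgue n) (punctured_ball n)"
  have "(\<integral>y. g y \<partial>sphere_measure n) = (\<integral>y. g (Rn_normalize n y) \<partial>restrict_space ?U (punctured_ball n))"
    unfolding sphere_measure_eq
    by (rule integral_distr[OF Rn_normalize_measurable_uniform]) (simp add: measurable_restrict_space1)
  also have "\<dots> = (\<integral>y. indicator (punctured_ball n) y *\<^sub>R g (Rn_normalize n y) \<partial>?U)"
  proof (rule integral_restrict_space)
    have "punctured_ball n \<inter> space ?U = punctured_ball n" by auto
    then show "punctured_ball n \<inter> space ?U \<in> sets ?U" using punctured_ball_sets by simp
  qed
  finally show ?thesis by simp
qed

lemma distr_uniform_Rn_rotate:
  assumes ij: "i < n" "j < n" "i \<noteq> j" and cs: "c\<^sup>2 + s\<^sup>2 = 1" "s \<noteq> 0"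
  shows "distr (uniform_measure (Rn_lebesgue n) (punctured_ball n)) (uniform_measure (Rn_lebesgue n) (punctured_ball n))
    (Rn_rotate i j c s) = uniform_measure (Rn_lebesgue n) (punctured_ball n)"
    (is "distr ?U ?U ?R = ?U")
proof (rule measure_eqI)
  have R[measurable]: "?R \<in> measurable (Rn_lebesgue n) (Rn_lebesgue n)"
    using ij by (intro Rn_rotate_measurable)
  fix A assume "A \<in> sets (distr ?U ?U ?R)"
  then have A[measurable]: "A \<in> sets (Rn_lebesgue n)" by simp
  have RU: "?R \<in> measurable ?U ?U" using R by (simp cong: measurable_cong_sets)
  have vA: "?R -` A \<inter> Rn n \<in> sets (Rn_lebesgue n)"
    using measurable_sets[OF R A] by simp
  have "emeasure (distr ?U ?U ?R) A = emeasure ?U (?R -` A \<inter> Rn n)"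
    using emeasure_distr[OF RU, of A] A by simp
  also have "\<dots> = emeasure (Rn_lebesgue n) (punctured_ball n \<inter> (?R -` A \<inter> Rn n)) / emeasure (Rn_lebesgue n) (punctured_ball n)"
    using vA by simp
  also have "punctured_ball n \<inter> (?R -` A \<inter> Rn n) = ?R -` (punctured_ball n \<inter> A) \<inter> space (Rn_lebesgue n)"
    using Rn_rotate_in ij Rn_norm_rotate[OF ij cs(1)] by auto
  also have "emeasure (Rn_lebesgue n) \<dots> = emeasure (distr (Rn_lebesgue n) (Rn_lebesgue n) ?R) (punctured_ball n \<inter> A)"
    by (rule emeasure_distr[symmetric]) auto
  also have "\<dots> = emeasure (Rn_lebesgue n) (punctured_ball n \<inter> A)"
    by (simp add: distr_Rn_rotate[OF ij cs])
  finally show "emeasure (distr ?U ?U ?R) A = emeasure ?U A" by simp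
qed simp

section \<open>Rotation invariance of zonal integrals\<close>

definition zonal_integral :: "nat \<Rightarrow> (real \<Rightarrow> real) \<Rightarrow> (nat \<Rightarrow> real) \<Rightarrow> real" where
  "zonal_integral n F x = (\<integral>y. F (Rn_inner n x y) \<partial>sphere_measure n)"

text \<open>Rotating the variable of integration as well leaves the measure unchanged and restores
  the original inner product.\<close>

lemma zonal_integral_rotate:
  assumes ij: "i < n" "j < n" "i \<noteq> j" and cs: "c\<^sup>2 + s\<^sup>2 = 1" "s \<noteq> 0"
    and F[measurable]: "F \<in> borel_measurable borel"
  shows "zonal_integral n F (Rn_rotate i j c s x) = zonal_integral n F x"
proof -
  let ?U = "uniform_measure (Rn_lebesgue n) (punctured_ball n)"
  let ?R = "Rn_rotate i j c s"
  let ?g = "\<lambda>x y. indicator (punctured_ball n) y * F (Rn_inner n x y / Rn_norm n y)"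
  have R: "?R \<in> measurable ?U ?U"
    using Rn_rotate_measurable[OF ij(1,2)] by (simp cong: measurable_cong_sets)
  have z: "zonal_integral n F x = (\<integral>y. ?g x y \<partial>?U)" for x
    unfolding zonal_integral_def by (subst integral_sphere_measure) (auto simp: Rn_inner_normalize)
  have "zonal_integral n F (?R x) = (\<integral>y. ?g (?R x) y \<partial>distr ?U ?U ?R)"
    unfolding z distr_uniform_Rn_rotate[OF ij cs] ..
  also have "\<dots> = (\<integral>y. ?g (?R x) (?R y) \<partial>?U)"
    by (rule integral_distr[OF R]) measurable
  also have "\<dots> = (\<integral>y. ?g x y \<partial>?U)"
    using Rn_rotate_in ij Rn_norm_rotate[OF ij cs(1)] Rn_inner_rotate[OF ij cs(1)]
    by (intro Bochner_Integration.integral_cong) (auto simp: indicator_def)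
  finally show ?thesis unfolding z .
qed

text \<open>Plane rotations carry every unit vector to the first basis vector: by induction on a
  bound for the last nonzero index, a rotation in the plane of coordinates 0 and
  \<open>Suc k\<close> clears coordinate \<open>Suc k\<close>, until only a sign is left.\<close>

lemma zonal_integral_const:
  assumes n: "2 \<le> n" and F: "F \<in> borel_measurable borel" and x: "x \<in> Rn_sphere n"
  shows "zonal_integral n F x = zonal_integral n F (\<lambda>i\<in>{..<n}. if i = 0 then 1 else 0)"
proof -
  let ?e = "\<lambda>i\<in>{..<n}. if i = 0 then 1 else 0 :: real"
  have "zonal_integral n F x = zonal_integral n F ?e"
    if "x \<in> Rn_sphere n" "k < n" "\<And>j. k < j \<Longrightarrow> j < n \<Longrightarrow> x j = 0" for k x
    using that
  proof (induction k arbitrary: x)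
    case 0
    have x: "x \<in> Rn n" "Rn_norm n x = 1" using 0 by (auto simp: Rn_sphere_def)
    have "(Rn_norm n x)\<^sup>2 = (\<Sum>i<n. if i = 0 then (x 0)\<^sup>2 else 0)"
      unfolding Rn_norm_sqr Rn_inner_def using 0 by (intro sum.cong) (auto simp: power2_eq_square)
    then have "(x 0)\<^sup>2 = 1" using x n by simp
    then consider "x 0 = 1" | "x 0 = -1" by (auto simp: power2_eq_1_iff)
    then show ?case
    proof cases
      case 1
      then have "x = ?e" using x 0 by (auto simp: fun_eq_iff Rn_def PiE_def extensional_def)
      then show ?thesis by simp
    next
      case 2
      \<comment> \<open>A half turn has \<open>s = 0\<close>, where the factorization into shears
        breaks down, so the sign is changed by two quarter turns in the plane of coordinates 0 and
        1.\<close>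
      let ?R = "Rn_rotate 0 1 0 1"
      have "zonal_integral n F (?R (?R x)) = zonal_integral n F x"
        using zonal_integral_rotate[of 0 n 1 0 1 F] n F by simp
      moreover have "?R (?R x) = ?e"
        using x 0 2 n by (auto simp: fun_eq_iff Rn_def PiE_def extensional_def Rn_rotate_def)
      ultimately show ?thesis by (simp only:)
    qed
  next
    case (Suc k)
    show ?case
    proof (cases "x (Suc k) = 0")
      case True
      show ?thesis
      proof (rule Suc.IH)
        fix j assume "k < j" "j < n"
        then show "x j = 0" using True Suc.prems(3)[of j] by (cases "j = Suc k") auto
      qed (use Suc.prems in auto)
    next
      case False
      define r where "r = sqrt ((x 0)\<^sup>2 + (x (Suc k))\<^sup>2)"
      \<comment> \<open>Chosen so that \<open>s * x 0 + c * x (Suc k) = 0\<close>, which is the new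
        coordinate \<open>Suc k\<close>.\<close>
      define c s where "c = x 0 / r" and "s = - x (Suc k) / r"
      have r2: "r\<^sup>2 = (x 0)\<^sup>2 + (x (Suc k))\<^sup>2" unfolding r_def by simp
      have r0: "0 < r" unfolding r_def using False by (simp add: add_nonneg_pos)
      have cs: "c\<^sup>2 + s\<^sup>2 = 1" "s \<noteq> 0"
        using r0 False by (auto simp: c_def s_def power_divide r2 add_divide_distrib[symmetric])
      have idx: "0 < n" "Suc k < n" "0 \<noteq> Suc k" using Suc.prems by auto
      let ?R = "Rn_rotate 0 (Suc k) c s"
      have "zonal_integral n F (?R x) = zonal_integral n F ?e"
      proof (rule Suc.IH)
        show "?R x \<in> Rn_sphere n"
          using Suc.prems(1) Rn_rotate_in[OF idx(1,2)] Rn_norm_rotate[OF idx cs(1)] by (simp add: Rn_sphere_def)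
        fix j assume "k < j" "j < n"
        then show "?R x j = 0" using Suc.prems(3)[of j]
          by (cases "j = Suc k") (auto simp: Rn_rotate_def c_def s_def)
      qed (use Suc.prems in auto)
      then show ?thesis using zonal_integral_rotate[OF idx cs F] by (simp only:)
    qed
  qed
  from this[of x "n - 1"] show ?thesis using x n by simp
qed

section \<open>The double integral over the sphere as an affine minimum\<close>

lemma sphere_inner_bounds:
  assumes "x \<in> Rn_sphere n" "y \<in> Rn_sphere n"
  shows "Rn_inner n x y \<in> {-1..1}"
  using Rn_inner_abs_le[of n x y] assms by (auto simp: Rn_sphere_def)

lemma Rn_sphere_nonempty:
  assumes "0 < n"
  shows "Rn_sphere n \<noteq> {}"
proof -
  have "Rn_normalize n (\<lambda>i\<in>{..<n}. if i = 0 then 1 else 0) \<in> Rn_sphere n"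
    using assms by (intro Rn_normalize_sphere) (auto simp: Rn_norm_def L2_set_def intro!: sum_pos2[of _ 0])
  then show ?thesis by blast
qed

lemma sphere_psd_kernel:
  assumes "0 < n" "sphere_positive_type n f" "f 1 = 1"
  shows "psd_kernel (Rn_sphere n) (\<lambda>x y. f (Rn_inner n x y))"
proof
  show "f (Rn_inner n x x) = 1" if "x \<in> Rn_sphere n" for x
    using that assms(3) by (simp add: Rn_norm_sqr[symmetric] Rn_sphere_def)
qed (use assms Rn_sphere_nonempty in \<open>auto simp: sphere_positive_type_def\<close>)

text \<open>By rotation invariance all inner integrals equal one constant \<open>h\<close>.
  Integrating the estimate of \<open>near_minimizer\<close> over \<open>y\<close> turns every row of
  the kernel into \<open>h\<close>; the weights sum to 1, so \<open>h\<close> lies within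
  \<open>5 * s\<close> of \<open>mu\<close> for every small \<open>s\<close>.\<close>

lemma sphere_integral_eq_mu:
  assumes n: "2 \<le> n" and f: "continuous_on {-1..1} f" "sphere_positive_type n f" "f 1 = 1"
  shows "sphere_integral n f = psd_kernel.mu (Rn_sphere n) (\<lambda>x y. f (Rn_inner n x y))"
proof -
  interpret K: psd_kernel "Rn_sphere n" "\<lambda>x y. f (Rn_inner n x y)"
    using n f by (intro sphere_psd_kernel) auto
  let ?w = "sphere_measure n"
  interpret w: finite_measure ?w
    by standard (use emeasure_space_sphere_measure[of n] n in simp)
  have w1: "measure ?w (Rn_sphere n) = 1"
    using emeasure_space_sphere_measure[of n] n by (simp add: measure_def)
  \<comment> \<open>Continuity of \<open>f\<close> is given on \<open>[-1,1]\<close> alone. Clipping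
    the argument produces a continuous function on the line that agrees with \<open>f\<close> at
    inner products of unit vectors.\<close>
  define F where "F r = f (max (-1) (min 1 r))" for r
  have "continuous_on UNIV F" unfolding F_def
    by (intro continuous_on_compose2[OF f(1)] continuous_intros) auto
  then have F[measurable]: "F \<in> borel_measurable borel" by (rule borel_measurable_continuous_onI)
  have Ff: "F (Rn_inner n x y) = f (Rn_inner n x y)" if "x \<in> Rn_sphere n" "y \<in> Rn_sphere n" for x y
    using sphere_inner_bounds[OF that] by (simp add: F_def)
  define h where "h = zonal_integral n F (\<lambda>i\<in>{..<n}. if i = 0 then 1 else 0)"
  have h: "(\<integral>y. f (Rn_inner n x y) \<partial>?w) = h" if "x \<in> Rn_sphere n" for x
  proof -
    have "(\<integral>y. f (Rn_inner n x y) \<partial>?w) = zonal_integral n F x"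
      unfolding zonal_integral_def using Ff that by (intro Bochner_Integration.integral_cong) auto
    then show ?thesis using zonal_integral_const[OF n F that] by (simp add: h_def)
  qed
  have "sphere_integral n f = (\<integral>x. h \<partial>?w)"
    unfolding sphere_integral_def using h by (intro Bochner_Integration.integral_cong) auto
  also have "\<dots> = h" using w1 by simp
  finally have Ih: "sphere_integral n f = h" .
  have int: "integrable ?w (\<lambda>y. f (Rn_inner n x y))" if x: "x \<in> Rn_sphere n" for x
  proof (rule w.integrable_const_bound[where B = 1])
    show "AE y in ?w. norm (f (Rn_inner n x y)) \<le> 1"
      using K.abs_le_1[OF x] by (intro AE_I2) simp
    have "(\<lambda>y. F (Rn_inner n x y)) \<in> borel_measurable (Rn_lebesgue n)" by measurable
    then have "(\<lambda>y. F (Rn_inner n x y)) \<in> borel_measurable ?w"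
      by (subst measurable_cong_sets[OF sets_sphere_measure refl]) (rule measurable_restrict_space1)
    then show "(\<lambda>y. f (Rn_inner n x y)) \<in> borel_measurable ?w"
      using Ff[OF x] by (subst measurable_cong[where g = "\<lambda>y. F (Rn_inner n x y)"]) auto
  qed
  have close: "\<bar>h - K.mu\<bar> \<le> 5 * s" if s: "0 < s" "s \<le> 1" for s
  proof -
    obtain U c where U: "finite U" "U \<subseteq> Rn_sphere n" "sum c U = 1"
      and near: "\<And>y. y \<in> Rn_sphere n \<Longrightarrow> \<bar>(\<Sum>x\<in>U. c x * f (Rn_inner n x y)) - K.mu\<bar> \<le> 5 * s"
      using K.near_minimizer[OF s] by blast
    have i: "integrable ?w (\<lambda>y. \<Sum>x\<in>U. c x * f (Rn_inner n x y))"
      using int U by (intro Bochner_Integration.integrable_sum integrable_mult_right) auto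
    have "(\<integral>y. (\<Sum>x\<in>U. c x * f (Rn_inner n x y)) \<partial>?w) = (\<Sum>x\<in>U. c x * (\<integral>y. f (Rn_inner n x y) \<partial>?w))"
      using int U by (subst Bochner_Integration.integral_sum) (auto intro!: sum.cong integrable_mult_right)
    also have "\<dots> = (\<Sum>x\<in>U. c x * h)" using h U by (intro sum.cong) auto
    also have "\<dots> = h" using U by (simp add: sum_distrib_right[symmetric])
    finally have "(\<integral>y. (\<Sum>x\<in>U. c x * f (Rn_inner n x y)) - K.mu \<partial>?w) = h - K.mu"
      using i w1 by (subst Bochner_Integration.integral_diff) auto
    moreover have "norm (\<integral>y. (\<Sum>x\<in>U. c x * f (Rn_inner n x y)) - K.mu \<partial>?w) \<le> (\<integral>y. 5 * s \<partial>?w)"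
      by (rule order_trans[OF integral_norm_bound], rule integral_mono) (use i near in auto)
    ultimately show ?thesis using w1 by simp
  qed
  have "h = K.mu"
  proof (rule ccontr)
    assume ne: "h \<noteq> K.mu"
    define s where "s = min 1 (\<bar>h - K.mu\<bar> / 10)"
    have "0 < s" "s \<le> 1" "10 * s \<le> \<bar>h - K.mu\<bar>" using ne by (auto simp: s_def min_def)
    then show False using close[of s] ne by auto
  qed
  then show ?thesis using Ih by simp
qed

section \<open>Mean values on Euclidean space\<close>

text \<open>Restriction to the first \<open>n\<close> coordinates maps
  \<open>nat \<Rightarrow> real\<close> continuously onto \<open>Rn n\<close> and fixes
  \<open>Rn n\<close>, so \<open>f\<close> after restriction is Borel on the whole product space,
  whose Borel sets are those of the product sigma-algebra.\<close>

lemma continuous_on_Rn_measurable: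
  fixes f :: "(nat \<Rightarrow> real) \<Rightarrow> real"
  assumes f: "continuous_on (Rn n) f"
  shows "f \<in> borel_measurable (Rn_lebesgue n)"
proof -
  have "continuous_on UNIV (\<lambda>x :: nat \<Rightarrow> real. restrict x {..<n})"
  proof (rule continuous_on_coordinatewise_then_product)
    fix i show "continuous_on UNIV (\<lambda>x :: nat \<Rightarrow> real. restrict x {..<n} i)"
      by (cases "i < n") (auto intro: continuous_on_product_coordinates)
  qed
  then have "continuous_on UNIV (\<lambda>x. f (restrict x {..<n}))"
    by (rule continuous_on_compose2[OF f]) (auto simp: Rn_def split: if_splits)
  then have g: "(\<lambda>x. f (restrict x {..<n})) \<in> borel_measurable borel"
    by (rule borel_measurable_continuous_onI)
  have "(\<lambda>x. x) \<in> measurable (Rn_lebesgue n) (Pi\<^sub>M UNIV (\<lambda>_. borel :: real measure))"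
  proof (rule measurable_PiM_single')
    fix i :: nat
    show "(\<lambda>x. x i) \<in> borel_measurable (Rn_lebesgue n)"
    proof (cases "i < n")
      case False
      \<comment> \<open>Extensional functions take the default value at every index beyond the
        dimension, so these coordinates are constant and hence measurable.\<close>
      then have "\<And>x. x \<in> space (Rn_lebesgue n) \<Longrightarrow> x i = undefined"
        by (auto simp: Rn_def PiE_def extensional_def)
      then show ?thesis by (subst measurable_cong[where g = "\<lambda>_. undefined"]) auto
    qed simp
  qed auto
  then have "(\<lambda>x. x) \<in> measurable (Rn_lebesgue n) borel"
    by (simp add: measurable_cong_sets[OF refl sets_PiM_equal_borel])
  from measurable_compose[OF this g]
  have "(\<lambda>x. f (restrict x {..<n})) \<in> borel_measurable (Rn_lebesgue n)" .
  then show ?thesis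
    by (rule measurable_cong[THEN iffD1, rotated]) (auto simp: Rn_def PiE_restrict)
qed

lemma Rn_diff_in [simp]: "Rn_diff n x y \<in> Rn n"
  by (simp add: Rn_diff_def Rn_def)

lemma Rn_zero_in [simp]: "Rn_zero n \<in> Rn n"
  by (simp add: Rn_zero_def Rn_def)

lemma Rn_diff_self [simp]: "Rn_diff n x x = Rn_zero n"
  by (simp add: Rn_diff_def Rn_zero_def)

lemma Rn_diff_zero [simp]: "x \<in> Rn n \<Longrightarrow> Rn_diff n x (Rn_zero n) = x"
  by (auto simp: Rn_diff_def Rn_zero_def Rn_def PiE_def extensional_def fun_eq_iff)

lemma Rn_diff_measurable: "(\<lambda>x. Rn_diff n x a) \<in> measurable (Rn_lebesgue n) (Rn_lebesgue n)"
  by (rule Rn_measurable_componentwise) (auto simp: Rn_diff_def Rn_def)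

text \<open>Boxes determine the product measure, and on a box translation invariance holds factor by
  factor.\<close>

lemma distr_Rn_diff: "distr (Rn_lebesgue n) (Rn_lebesgue n) (\<lambda>x. Rn_diff n x a) = Rn_lebesgue n"
proof -
  interpret product_sigma_finite "\<lambda>_::nat. lborel :: real measure" by standard
  have "distr (Rn_lebesgue n) (Rn_lebesgue n) (\<lambda>x. Rn_diff n x a) = Pi\<^sub>M {..<n} (\<lambda>_. lborel)"
  proof (rule PiM_eqI)
    show "sets (distr (Rn_lebesgue n) (Rn_lebesgue n) (\<lambda>x. Rn_diff n x a)) = sets (Pi\<^sub>M {..<n} (\<lambda>_. lborel))"
      by (simp add: Rn_lebesgue_def)
    fix A :: "nat \<Rightarrow> real set"
    assume A: "\<And>i. i \<in> {..<n} \<Longrightarrow> A i \<in> sets lborel"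
    let ?B = "\<lambda>i. (+) (- a i) -` A i"
    have B: "?B i \<in> sets lborel" if "i < n" for i
      using measurable_sets[of "(+) (- a i)" borel borel "A i"] A that by simp
    have "Pi\<^sub>E {..<n} A \<in> sets (Rn_lebesgue n)"
      unfolding Rn_lebesgue_def using A by (intro sets_PiM_I_finite) auto
    then have "emeasure (distr (Rn_lebesgue n) (Rn_lebesgue n) (\<lambda>x. Rn_diff n x a)) (Pi\<^sub>E {..<n} A)
        = emeasure (Rn_lebesgue n) ((\<lambda>x. Rn_diff n x a) -` (Pi\<^sub>E {..<n} A) \<inter> Rn n)"
      by (subst emeasure_distr[OF Rn_diff_measurable]) auto
    also have "(\<lambda>x. Rn_diff n x a) -` (Pi\<^sub>E {..<n} A) \<inter> Rn n = Pi\<^sub>E {..<n} ?B"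
      by (auto simp: Rn_diff_def Rn_def PiE_def extensional_def Pi_def)
    also have "emeasure (Rn_lebesgue n) (Pi\<^sub>E {..<n} ?B) = (\<Prod>i<n. emeasure lborel (?B i))"
      unfolding Rn_lebesgue_def using B by (intro emeasure_PiM) auto
    also have "\<dots> = (\<Prod>i<n. emeasure lborel (A i))"
    proof (rule prod.cong[OF refl])
      fix i assume "i \<in> {..<n}"
      then have "emeasure (distr lborel borel ((+) (- a i))) (A i) = emeasure lborel (?B i)"
        using A[of i] by (subst emeasure_distr) auto
      then show "emeasure lborel (?B i) = emeasure lborel (A i)"
        by (simp only: lborel_distr_plus)
    qed
    finally show "emeasure (distr (Rn_lebesgue n) (Rn_lebesgue n) (\<lambda>x. Rn_diff n x a)) (Pi\<^sub>E {..<n} A)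
      = (\<Prod>i<n. emeasure lborel (A i))" .
  qed simp
  then show ?thesis by (simp add: Rn_lebesgue_def)
qed

section \<open>Averages over large cubes\<close>

abbreviation Rn_cube :: "nat \<Rightarrow> real \<Rightarrow> (nat \<Rightarrow> real) set" where
  "Rn_cube n T \<equiv> \<Pi>\<^sub>E i\<in>{..<n}. {-T..T}"

lemma Rn_cube_sets [measurable]: "Rn_cube n T \<in> sets (Rn_lebesgue n)"
  unfolding Rn_lebesgue_def by (intro sets_PiM_I_finite) auto

lemma emeasure_Rn_cube:
  assumes "0 \<le> T"
  shows "emeasure (Rn_lebesgue n) (Rn_cube n T) = ennreal ((2 * T) ^ n)"
proof -
  interpret product_sigma_finite "\<lambda>_::nat. lborel :: real measure" by standard
  have "emeasure (Rn_lebesgue n) (Rn_cube n T) = (\<Prod>i<n. emeasure lborel {-T..T})"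
    unfolding Rn_lebesgue_def by (intro emeasure_PiM) auto
  also have "\<dots> = (\<Prod>i<n. ennreal (2 * T))" using assms by (intro prod.cong) auto
  also have "\<dots> = ennreal ((2 * T) ^ n)" using assms by (simp add: ennreal_power)
  finally show ?thesis .
qed

lemma measure_Rn_cube: "0 \<le> T \<Longrightarrow> measure (Rn_lebesgue n) (Rn_cube n T) = (2 * T) ^ n"
  by (simp add: measure_def emeasure_Rn_cube)

lemma integral_Rn_cube:
  assumes "0 \<le> T"
  shows "(\<integral>x. indicator (Rn_cube n T) x \<partial>Rn_lebesgue n) = (2 * T) ^ n"
proof -
  have "Rn_cube n T \<inter> Rn n = Rn_cube n T" by (auto simp: Rn_def)
  then show ?thesis using measure_Rn_cube[OF assms, of n] by simp
qed

lemma integrable_Rn_cube: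
  fixes g :: "(nat \<Rightarrow> real) \<Rightarrow> real"
  assumes "g \<in> borel_measurable (Rn_lebesgue n)" "\<And>x. x \<in> Rn n \<Longrightarrow> \<bar>g x\<bar> \<le> 1" "0 \<le> T"
  shows "integrable (Rn_lebesgue n) (\<lambda>x. indicator (Rn_cube n T) x * g x)"
proof (rule Bochner_Integration.integrable_bound)
  show "integrable (Rn_lebesgue n) (\<lambda>x. indicator (Rn_cube n T) x :: real)"
    using assms by (intro integrable_real_indicator) (auto simp: emeasure_Rn_cube)
  show "(\<lambda>x. indicator (Rn_cube n T) x * g x) \<in> borel_measurable (Rn_lebesgue n)"
    using assms(1) by measurable
  show "AE x in Rn_lebesgue n. norm (indicator (Rn_cube n T) x * g x) \<le> norm (indicator (Rn_cube n T) x :: real)"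
    using assms(2) by (intro AE_I2) (auto simp: indicator_def)
qed

text \<open>The cube of side \<open>2 T\<close> and its translate by \<open>a\<close> both contain the concentric cube of side \<open>2 (T - R)\<close>.\<close>
lemma cube_average_translate:
  fixes g :: "(nat \<Rightarrow> real) \<Rightarrow> real"
  assumes g: "g \<in> borel_measurable (Rn_lebesgue n)" "\<And>x. x \<in> Rn n \<Longrightarrow> \<bar>g x\<bar> \<le> 1"
    and R: "0 \<le> R" "\<And>i. i < n \<Longrightarrow> \<bar>a i\<bar> \<le> R" "R \<le> T"
  shows "\<bar>(\<integral>x. indicator (Rn_cube n T) x * g (Rn_diff n x a) \<partial>Rn_lebesgue n)
      - (\<integral>x. indicator (Rn_cube n (T - R)) x * g x \<partial>Rn_lebesgue n)\<bar> \<le> (2 * T) ^ n - (2 * (T - R)) ^ n"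
proof -
  let ?P = "Rn_lebesgue n"
  note [measurable] = g(1)
  define \<tau> where "\<tau> x = Rn_diff n x a" for x
  have \<tau>[measurable]: "\<tau> \<in> measurable ?P ?P" unfolding \<tau>_def by (rule Rn_diff_measurable)
  have d: "distr ?P ?P \<tau> = ?P" unfolding \<tau>_def by (rule distr_Rn_diff)
  have tr: "(\<integral>x. h x \<partial>?P) = (\<integral>x. h (\<tau> x) \<partial>?P)" if "h \<in> borel_measurable ?P" for h :: "(nat \<Rightarrow> real) \<Rightarrow> real"
    using integral_distr[OF \<tau>, of h] that by (simp add: d)
  have gt: "(\<lambda>x. g (\<tau> x)) \<in> borel_measurable ?P" by measurable
  have bt: "\<bar>g (\<tau> x)\<bar> \<le> 1" for x unfolding \<tau>_def by (rule g) simp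
  let ?C = "Rn_cube n T" and ?D = "Rn_cube n (T - R)"
  have sub: "indicator ?D (\<tau> x) \<le> (indicator ?C x :: real)" if "x \<in> Rn n" for x
  proof -
    have "x \<in> ?C" if D: "\<tau> x \<in> ?D"
    proof -
      have "\<bar>x i\<bar> \<le> T" if "i < n" for i
      proof -
        have "\<tau> x i \<in> {-(T-R)..T-R}" using D that by (auto simp: PiE_def Pi_def)
        then show ?thesis using R(2)[OF that] that by (auto simp: \<tau>_def Rn_diff_def)
      qed
      then show ?thesis using \<open>x \<in> Rn n\<close> by (auto simp: Rn_def PiE_def abs_le_iff) (metis minus_le_iff)
    qed
    then show ?thesis by (auto simp: indicator_def)
  qed
  have gD: "(\<lambda>x. indicator ?D x * g x) \<in> borel_measurable ?P" by measurable
  have i1: "integrable ?P (\<lambda>x. indicator ?C x * g (\<tau> x))" using gt bt R by (intro integrable_Rn_cube) auto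
  have i2: "integrable ?P (\<lambda>x. indicator ?D (\<tau> x) * g (\<tau> x))"
  proof (rule integrable_distr[OF \<tau>])
    show "integrable (distr ?P ?P \<tau>) (\<lambda>x. indicator ?D x * g x)"
      unfolding d using integrable_Rn_cube[OF g, of "T - R"] R by simp
  qed
  have i3: "integrable ?P (\<lambda>x. indicator ?C x :: real)"
    using R integrable_Rn_cube[of "\<lambda>_. 1" n T] by simp
  have i4: "integrable ?P (\<lambda>x. indicator ?D (\<tau> x) :: real)"
  proof (rule integrable_distr[OF \<tau>])
    show "integrable (distr ?P ?P \<tau>) (\<lambda>x. indicator ?D x :: real)"
      unfolding d using integrable_Rn_cube[of "\<lambda>_. 1" n "T - R"] R by simp
  qed
  \<comment> \<open>Translating the integral over the small cube makes both integrands multiples of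
    \<open>g (\<tau> x)\<close>. By \<open>sub\<close> the difference of the indicators is
    nonnegative, and it integrates to the difference of the volumes.\<close>
  have "(\<integral>x. indicator ?C x * g (\<tau> x) \<partial>?P) - (\<integral>x. indicator ?D x * g x \<partial>?P)
      = (\<integral>x. indicator ?C x * g (\<tau> x) \<partial>?P) - (\<integral>x. indicator ?D (\<tau> x) * g (\<tau> x) \<partial>?P)"
    by (simp only: tr[OF gD])
  also have "\<dots> = (\<integral>x. (indicator ?C x - indicator ?D (\<tau> x)) * g (\<tau> x) \<partial>?P)"
    using i1 i2 by (simp add: left_diff_distrib)
  finally have eq: "(\<integral>x. indicator ?C x * g (\<tau> x) \<partial>?P) - (\<integral>x. indicator ?D x * g x \<partial>?P)
      = (\<integral>x. (indicator ?C x - indicator ?D (\<tau> x)) * g (\<tau> x) \<partial>?P)" .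
  have "norm (\<integral>x. (indicator ?C x - indicator ?D (\<tau> x)) * g (\<tau> x) \<partial>?P)
      \<le> (\<integral>x. norm ((indicator ?C x - indicator ?D (\<tau> x)) * g (\<tau> x)) \<partial>?P)"
    by (rule integral_norm_bound)
  also have "\<dots> \<le> (\<integral>x. indicator ?C x - indicator ?D (\<tau> x) \<partial>?P)"
  proof (rule integral_mono)
    show "integrable ?P (\<lambda>x. norm ((indicator ?C x - indicator ?D (\<tau> x)) * g (\<tau> x)))"
      using i1 i2 by (intro integrable_norm) (simp add: left_diff_distrib)
    fix x assume "x \<in> space ?P"
    then have "0 \<le> (indicator ?C x - indicator ?D (\<tau> x) :: real)" using sub[of x] by simp
    then have "\<bar>indicator ?C x - indicator ?D (\<tau> x)\<bar> * \<bar>g (\<tau> x)\<bar> \<le> (indicator ?C x - indicator ?D (\<tau> x)) * 1"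
      by (intro mult_mono) (auto simp: bt)
    then show "norm ((indicator ?C x - indicator ?D (\<tau> x)) * g (\<tau> x)) \<le> indicator ?C x - indicator ?D (\<tau> x)"
      by (simp add: abs_mult)
  qed (use i3 i4 in simp)
  also have "\<dots> = (\<integral>x. indicator ?C x \<partial>?P) - (\<integral>x. indicator ?D (\<tau> x) \<partial>?P)"
    using i3 i4 by simp
  also have "(\<integral>x. indicator ?D (\<tau> x) \<partial>?P) = (\<integral>x. indicator ?D x \<partial>?P :: real)"
    by (rule tr[symmetric]) measurable
  also have "(\<integral>x. indicator ?C x \<partial>?P) - (\<integral>x. indicator ?D x \<partial>?P :: real) = (2 * T) ^ n - (2 * (T - R)) ^ n"
    using R by (subst (1 2) integral_Rn_cube) auto
  finally show ?thesis using eq by (simp add: \<tau>_def)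
qed

lemma Rn_psd_kernel:
  assumes "Rn_positive_type n f" "f (Rn_zero n) = 1"
  shows "psd_kernel (Rn n) (\<lambda>x y. f (Rn_diff n x y))"
  by standard (use assms Rn_zero_in in \<open>auto simp: Rn_positive_type_def simp del: Rn_zero_in\<close>)

text \<open>Over large cubes a translate of \<open>f\<close> has nearly the same average as
  \<open>f\<close>. Averaging the estimate of \<open>near_minimizer\<close> over \<open>y\<close>
  therefore keeps the averages of \<open>f\<close> eventually close to \<open>mu\<close>; this
  proves convergence, so that \<open>Lim\<close> takes the value \<open>mu\<close>.\<close>

lemma mean_value_eq_mu:
  assumes f: "continuous_on (Rn n) f" "Rn_positive_type n f" "f (Rn_zero n) = 1"
  shows "mean_value n f = psd_kernel.mu (Rn n) (\<lambda>x y. f (Rn_diff n x y))"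
proof -
  let ?P = "Rn_lebesgue n"
  interpret K: psd_kernel "Rn n" "\<lambda>x y. f (Rn_diff n x y)"
    using f by (intro Rn_psd_kernel)
  have fm[measurable]: "f \<in> borel_measurable ?P" using f by (intro continuous_on_Rn_measurable)
  have f1: "\<bar>f x\<bar> \<le> 1" if "x \<in> Rn n" for x
    using K.abs_le_1[OF that Rn_zero_in] that by simp
  define avg where "avg g T = (\<integral>x. indicator (Rn_cube n T) x * g x \<partial>?P) / (2 * T) ^ n" for g T
  have trans_lim: "((\<lambda>T. avg (\<lambda>x. f (Rn_diff n x a)) T - avg f T) \<longlongrightarrow> 0) at_top" for a
  proof -
    define R where "R = (\<Sum>i<n. \<bar>a i\<bar>)"
    have R: "0 \<le> R" "\<And>i. i < n \<Longrightarrow> \<bar>a i\<bar> \<le> R" unfolding R_def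
      by (auto intro!: sum_nonneg member_le_sum[of _ "{..<n}" "\<lambda>i. \<bar>a i\<bar>"])
    have b: "\<bar>avg (\<lambda>x. f (Rn_diff n x a)) T - avg f T\<bar> \<le> 2 * (1 - (1 - R / T) ^ n)"
      if T: "R \<le> T" "0 < T" for T
    proof -
      \<comment> \<open>Writing \<open>f\<close> as its translate by zero lets
        \<open>cube_average_translate\<close> compare both averages with the same smaller cube,
        which explains the factor 2 in the bound.\<close>
      have z: "(\<integral>x. indicator (Rn_cube n T) x * f (Rn_diff n x (Rn_zero n)) \<partial>?P) = (\<integral>x. indicator (Rn_cube n T) x * f x \<partial>?P)"
        by (intro Bochner_Integration.integral_cong) auto
      have "\<bar>(\<integral>x. indicator (Rn_cube n T) x * f (Rn_diff n x a) \<partial>?P) - (\<integral>x. indicator (Rn_cube n T) x * f x \<partial>?P)\<bar>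
          \<le> 2 * ((2 * T) ^ n - (2 * (T - R)) ^ n)"
      proof -
        have "\<bar>(\<integral>x. indicator (Rn_cube n T) x * f (Rn_diff n x a) \<partial>?P)
            - (\<integral>x. indicator (Rn_cube n (T - R)) x * f x \<partial>?P)\<bar> \<le> (2 * T) ^ n - (2 * (T - R)) ^ n"
          by (rule cube_average_translate[OF fm f1 R T(1)])
        moreover have "\<bar>(\<integral>x. indicator (Rn_cube n T) x * f x \<partial>?P)
            - (\<integral>x. indicator (Rn_cube n (T - R)) x * f x \<partial>?P)\<bar> \<le> (2 * T) ^ n - (2 * (T - R)) ^ n"
          unfolding z[symmetric]
          by (rule cube_average_translate[OF fm f1 R(1) _ T(1)]) (use R in \<open>auto simp: Rn_zero_def\<close>)
        moreover have "\<bar>p - q\<bar> \<le> 2 * e" if "\<bar>p - l\<bar> \<le> e" "\<bar>q - l\<bar> \<le> e" for p q l e :: real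
          using that by linarith
        ultimately show ?thesis by blast
      qed
      then have "\<bar>avg (\<lambda>x. f (Rn_diff n x a)) T - avg f T\<bar> \<le> 2 * ((2 * T) ^ n - (2 * (T - R)) ^ n) / (2 * T) ^ n"
        unfolding avg_def diff_divide_distrib[symmetric] abs_divide using T
        by (simp add: divide_right_mono)
      also have "\<dots> = 2 * (1 - ((2 * (T - R)) / (2 * T)) ^ n)"
        using T by (subst power_divide) (simp add: diff_divide_distrib)
      also have "(2 * (T - R)) / (2 * T) = 1 - R / T" using T by (simp add: field_simps)
      finally show ?thesis .
    qed
    have "((\<lambda>T. 2 * (1 - (1 - R / T) ^ n)) \<longlongrightarrow> 2 * (1 - (1 - 0) ^ n)) at_top"
      by (intro tendsto_intros tendsto_divide_0[OF tendsto_const] filterlim_at_top_imp_at_infinity filterlim_ident)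
    then have lim: "((\<lambda>T. 2 * (1 - (1 - R / T) ^ n)) \<longlongrightarrow> 0) at_top" by simp
    show ?thesis
    proof (rule Lim_null_comparison[OF _ lim])
      show "\<forall>\<^sub>F T in at_top. norm (avg (\<lambda>x. f (Rn_diff n x a)) T - avg f T) \<le> 2 * (1 - (1 - R / T) ^ n)"
        using eventually_ge_at_top[of R] eventually_gt_at_top[of 0]
        by eventually_elim (use b in simp)
    qed
  qed
  have "(avg f \<longlongrightarrow> K.mu) at_top"
  proof (rule tendstoI)
    fix e :: real assume e: "0 < e"
    define s where "s = min 1 (e / 10)"
    have s: "0 < s" "s \<le> 1" "5 * s \<le> e / 2" using e by (auto simp: s_def min_def)
    obtain U w where U: "finite U" "U \<subseteq> Rn n" "sum w U = 1"
      and near: "\<And>y. y \<in> Rn n \<Longrightarrow> \<bar>(\<Sum>x\<in>U. w x * f (Rn_diff n x y)) - K.mu\<bar> \<le> 5 * s"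
      using K.near_minimizer[OF s(1,2)] by blast
    have near': "\<bar>(\<Sum>x\<in>U. w x * avg (\<lambda>y. f (Rn_diff n y x)) T) - K.mu\<bar> \<le> 5 * s" if T: "0 < T" for T
    proof -
      let ?C = "Rn_cube n T"
      have i: "integrable ?P (\<lambda>y. indicator ?C y * f (Rn_diff n y x))" for x
        using T Rn_diff_measurable[of n x] by (intro integrable_Rn_cube measurable_compose[OF _ fm]) (auto intro: f1)
      have iC: "integrable ?P (\<lambda>y. indicator ?C y :: real)"
        using integrable_Rn_cube[of "\<lambda>_. 1" n T] T by simp
      have mC: "(\<integral>y. indicator ?C y \<partial>?P) = (2 * T) ^ n"
        using T by (intro integral_Rn_cube) auto
      have "(\<Sum>x\<in>U. w x * avg (\<lambda>y. f (Rn_diff n y x)) T) - K.mu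
          = ((\<Sum>x\<in>U. w x * (\<integral>y. indicator ?C y * f (Rn_diff n y x) \<partial>?P)) - K.mu * (2 * T) ^ n) / (2 * T) ^ n"
        using T by (simp add: avg_def sum_divide_distrib diff_divide_distrib)
      also have "(\<Sum>x\<in>U. w x * (\<integral>y. indicator ?C y * f (Rn_diff n y x) \<partial>?P)) - K.mu * (2 * T) ^ n
          = (\<integral>y. (\<Sum>x\<in>U. w x * (indicator ?C y * f (Rn_diff n y x))) - K.mu * indicator ?C y \<partial>?P)"
        using i iC mC by (subst Bochner_Integration.integral_diff)
          (auto simp del: integral_indicator intro!: Bochner_Integration.integrable_sum)
      finally have eq: "(\<Sum>x\<in>U. w x * avg (\<lambda>y. f (Rn_diff n y x)) T) - K.mu
         = (\<integral>y. (\<Sum>x\<in>U. w x * (indicator ?C y * f (Rn_diff n y x))) - K.mu * indicator ?C y \<partial>?P) / (2 * T) ^ n" .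
      have "norm (\<integral>y. (\<Sum>x\<in>U. w x * (indicator ?C y * f (Rn_diff n y x))) - K.mu * indicator ?C y \<partial>?P)
          \<le> (\<integral>y. 5 * s * indicator ?C y \<partial>?P)"
      proof (rule order_trans[OF integral_norm_bound], rule integral_mono)
        show "integrable ?P (\<lambda>y. norm ((\<Sum>x\<in>U. w x * (indicator ?C y * f (Rn_diff n y x))) - K.mu * indicator ?C y))"
          using i iC by (intro integrable_norm Bochner_Integration.integrable_diff Bochner_Integration.integrable_sum) auto
        show "integrable ?P (\<lambda>y. 5 * s * indicator ?C y)" using iC by simp
        fix y assume "y \<in> space ?P"
        then have y: "y \<in> Rn n" by simp
        \<comment> \<open>The averages involve translates in \<open>y\<close>, while
          \<open>near_minimizer\<close> has the difference the other way round; symmetry of the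
          kernel exchanges the two.\<close>
        have "(\<Sum>x\<in>U. w x * f (Rn_diff n y x)) = (\<Sum>x\<in>U. w x * f (Rn_diff n x y))"
          using U y K.sym by (intro sum.cong) auto
        then have "\<bar>(\<Sum>x\<in>U. w x * f (Rn_diff n y x)) - K.mu\<bar> \<le> 5 * s" using near[OF y] by simp
        then show "norm ((\<Sum>x\<in>U. w x * (indicator ?C y * f (Rn_diff n y x))) - K.mu * indicator ?C y) \<le> 5 * s * indicator ?C y"
          by (auto simp: indicator_def)
      qed
      also have "\<dots> = 5 * s * (2 * T) ^ n" using mC by (simp del: integral_indicator)
      finally show ?thesis unfolding eq using T by (simp add: abs_divide divide_le_eq)
    qed
    have "((\<lambda>T. \<Sum>x\<in>U. w x * (avg (\<lambda>y. f (Rn_diff n y x)) T - avg f T)) \<longlongrightarrow> (\<Sum>x\<in>U. w x * 0)) at_top"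
      by (intro tendsto_sum tendsto_mult tendsto_const trans_lim)
    then have "\<forall>\<^sub>F T in at_top. \<bar>\<Sum>x\<in>U. w x * (avg (\<lambda>y. f (Rn_diff n y x)) T - avg f T)\<bar> < e / 2"
      using e by (auto dest!: tendstoD[where e = "e / 2"])
    then show "\<forall>\<^sub>F T in at_top. dist (avg f T) K.mu < e"
      using eventually_gt_at_top[of 0]
    proof eventually_elim
      case (elim T)
      have "(\<Sum>x\<in>U. w x * (avg (\<lambda>y. f (Rn_diff n y x)) T - avg f T))
          = (\<Sum>x\<in>U. w x * avg (\<lambda>y. f (Rn_diff n y x)) T) - avg f T"
        using U(3) by (simp add: right_diff_distrib sum_subtractf sum_distrib_right[symmetric])
      then show ?case using elim near'[of T] s(3) unfolding dist_real_def by linarith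
    qed
  qed
  moreover have "\<forall>\<^sub>F T in at_top. avg f T = 1 / measure ?P (Rn_cube n T) * (LINT x : Rn_cube n T | ?P. f x)"
    using eventually_gt_at_top[of 0]
    by eventually_elim (simp add: avg_def measure_Rn_cube set_lebesgue_integral_def)
  ultimately have "((\<lambda>T. 1 / measure ?P (Rn_cube n T) * (LINT x : Rn_cube n T | ?P. f x)) \<longlongrightarrow> K.mu) at_top"
    by (rule Lim_transform_eventually)
  then show ?thesis unfolding mean_value_def by (intro tendsto_Lim) auto
qed

section \<open>Krawtchouk values and kernels on the discrete cube\<close>

text \<open>Vertices of the discrete cube are encoded as subsets of \<open>{..<m}\<close>; this is a
  coordinate of the corresponding sign vector, and products of sign vectors become symmetric
  differences.\<close>

definition cube_sign :: "nat set \<Rightarrow> nat \<Rightarrow> real" where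
  "cube_sign y i = (if i \<in> y then -1 else 1)"

text \<open>The Walsh characters of the cube.\<close>

definition cube_char :: "nat set \<Rightarrow> nat set \<Rightarrow> real" where
  "cube_char S y = (\<Prod>i\<in>S. cube_sign y i)"

text \<open>The eigenvalue, at the character of \<open>S\<close>, of the graph joining vertices at
  Hamming distance \<open>d\<close>; for \<open>S \<subseteq> {..<m}\<close> it is the value of a
  Krawtchouk polynomial at \<open>card S\<close>.\<close>

definition krawtchouk :: "nat \<Rightarrow> nat \<Rightarrow> nat set \<Rightarrow> real" where
  "krawtchouk m d S = (\<Sum>y | y \<subseteq> {..<m} \<and> card y = d. cube_char S y)"

lemma krawtchouk_bij:
  assumes "bij_betw p {..<m} {..<m}" "S \<subseteq> {..<m}"
  shows "krawtchouk m d (p ` S) = krawtchouk m d S"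
proof -
  have inj: "inj_on p {..<m}" and im: "p ` {..<m} = {..<m}" using assms(1) by (auto simp: bij_betw_def)
  have "bij_betw ((`) p) {y. y \<subseteq> {..<m} \<and> card y = d} {y. y \<subseteq> {..<m} \<and> card y = d}"
  proof (rule bij_betw_imageI)
    show "inj_on ((`) p) {y. y \<subseteq> {..<m} \<and> card y = d}"
      using inj by (auto simp: inj_on_def inj_on_image_eq_iff[OF inj])
    show "(`) p ` {y. y \<subseteq> {..<m} \<and> card y = d} = {y. y \<subseteq> {..<m} \<and> card y = d}" (is "?l = ?r")
    proof
      show "?l \<subseteq> ?r" using im card_image[OF inj_on_subset[OF inj]] by auto
      show "?r \<subseteq> ?l"
      proof
        fix z assume z: "z \<in> ?r"
        then obtain y where y: "y \<subseteq> {..<m}" "z = p ` y" using im by (metis (mono_tags) mem_Collect_eq subset_imageE)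
        then show "z \<in> ?l" using z card_image[OF inj_on_subset[OF inj y(1)]] by auto
      qed
    qed
  qed
  from sum.reindex_bij_betw[OF this, of "cube_char (p ` S)"]
  have "krawtchouk m d (p ` S) = (\<Sum>y | y \<subseteq> {..<m} \<and> card y = d. cube_char (p ` S) (p ` y))"
    unfolding krawtchouk_def by simp
  also have "\<dots> = krawtchouk m d S"
    unfolding krawtchouk_def
  proof (intro sum.cong refl)
    fix y assume "y \<in> {y. y \<subseteq> {..<m} \<and> card y = d}"
    then show "cube_char (p ` S) (p ` y) = cube_char S y"
      unfolding cube_char_def using assms(2)
      by (subst prod.reindex) (auto intro!: prod.cong inj_on_subset[OF inj]
          simp: cube_sign_def inj_on_image_mem_iff[OF inj] subset_iff)
  qed
  finally show ?thesis .
qed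

text \<open>A bijection from \<open>S\<close> to \<open>T\<close> and one between their complements
  combine to a permutation of the coordinates, under which the sum is invariant.\<close>

lemma krawtchouk_cong_card:
  assumes "S \<subseteq> {..<m}" "T \<subseteq> {..<m}" "card S = card T"
  shows "krawtchouk m d S = krawtchouk m d T"
proof -
  have fin: "finite S" "finite T" using assms finite_subset by auto
  obtain f where f: "bij_betw f S T" using finite_same_card_bij[OF fin assms(3)] by blast
  have "card ({..<m} - S) = card ({..<m} - T)" using assms fin by (simp add: card_Diff_subset)
  then obtain g where g: "bij_betw g ({..<m} - S) ({..<m} - T)"
    using finite_same_card_bij[of "{..<m} - S" "{..<m} - T"] by auto
  define p where "p i = (if i \<in> S then f i else g i)" for i
  have "bij_betw p S T" using f by (subst bij_betw_cong[of _ _ f]) (auto simp: p_def)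
  moreover have "bij_betw p ({..<m} - S) ({..<m} - T)"
    using g by (subst bij_betw_cong[of _ _ g]) (auto simp: p_def)
  ultimately have "bij_betw p (S \<union> ({..<m} - S)) (T \<union> ({..<m} - T))" by (intro bij_betw_combine) auto
  then have "bij_betw p {..<m} {..<m}" using assms by (simp add: Un_absorb1)
  from krawtchouk_bij[OF this assms(1), of d] show ?thesis
    using \<open>bij_betw p S T\<close> by (simp add: bij_betw_def)
qed

lemma sum_cube_sign:
  assumes "y \<subseteq> {..<m}"
  shows "(\<Sum>i<m. cube_sign y i) = real m - 2 * real (card y)"
proof -
  have fin: "finite y" using assms finite_subset by auto
  have "(\<Sum>i<m. cube_sign y i) = (\<Sum>i<m. 1 - 2 * (if i \<in> y then 1 else 0))"
    by (intro sum.cong) (auto simp: cube_sign_def)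
  also have "\<dots> = real m - 2 * (\<Sum>i<m. if i \<in> y then 1 else 0)"
    by (simp add: sum_subtractf sum_distrib_left)
  also have "(\<Sum>i<m. if i \<in> y then 1 else 0 :: real) = real (card y)"
    using assms by (subst sum.inter_restrict[symmetric]) (auto simp: Int_absorb1)
  finally show ?thesis .
qed

text \<open>Multiplying a character by the sign of coordinate \<open>i\<close> toggles
  \<open>i\<close> in \<open>S\<close>. Summed over \<open>i\<close>, these signs give
  \<open>m - 2 * d\<close> on every set of size \<open>d\<close>.\<close>

lemma krawtchouk_rec:
  assumes S: "S \<subseteq> {..<m}"
  shows "(\<Sum>i\<in>{..<m} - S. krawtchouk m d (insert i S)) + (\<Sum>i\<in>S. krawtchouk m d (S - {i}))
    = (real m - 2 * real d) * krawtchouk m d S"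
proof -
  have fin: "finite S" using S finite_subset by auto
  let ?Y = "{y. y \<subseteq> {..<m} \<and> card y = d}"
  have ins: "(\<Sum>i\<in>{..<m} - S. cube_char (insert i S) y) = (\<Sum>i\<in>{..<m} - S. cube_sign y i) * cube_char S y" for y
    unfolding sum_distrib_right using fin by (intro sum.cong) (auto simp: cube_char_def)
  have del: "(\<Sum>i\<in>S. cube_char (S - {i}) y) = (\<Sum>i\<in>S. cube_sign y i) * cube_char S y" for y
    unfolding sum_distrib_right
  proof (intro sum.cong refl)
    fix i assume "i \<in> S"
    then have "cube_char S y = cube_sign y i * cube_char (S - {i}) y"
      unfolding cube_char_def using fin by (simp add: prod.remove)
    then show "cube_char (S - {i}) y = cube_sign y i * cube_char S y"
      by (auto simp: cube_sign_def)
  qed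
  have "(\<Sum>i\<in>{..<m} - S. krawtchouk m d (insert i S)) + (\<Sum>i\<in>S. krawtchouk m d (S - {i}))
    = (\<Sum>y\<in>?Y. (\<Sum>i\<in>{..<m} - S. cube_char (insert i S) y) + (\<Sum>i\<in>S. cube_char (S - {i}) y))"
    unfolding krawtchouk_def sum.distrib by (intro arg_cong2[of _ _ _ _ "(+)"] sum.swap)
  also have "\<dots> = (\<Sum>y\<in>?Y. (\<Sum>i<m. cube_sign y i) * cube_char S y)"
    unfolding ins del distrib_right[symmetric] using S
    by (simp add: sum.subset_diff[of S "{..<m}"])
  also have "\<dots> = (real m - 2 * real d) * krawtchouk m d S"
    unfolding krawtchouk_def sum_distrib_left
    by (intro sum.cong) (auto simp: sum_cube_sign)
  finally show ?thesis .
qed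

text \<open>Initial segments represent the sizes, which gives a three-term recurrence. At
  \<open>j = 0\<close> the truncated \<open>j - 1\<close> does no harm, because its coefficient
  vanishes.\<close>

lemma krawtchouk_rec_interval:
  assumes "j < m"
  shows "(real m - real j) * krawtchouk m d {..<Suc j} + real j * krawtchouk m d {..<j - 1}
    = (real m - 2 * real d) * krawtchouk m d {..<j}"
proof -
  have "(\<Sum>i\<in>{..<m} - {..<j}. krawtchouk m d (insert i {..<j}))
      = (\<Sum>i\<in>{..<m} - {..<j}. krawtchouk m d {..<Suc j})"
    using assms by (intro sum.cong krawtchouk_cong_card) auto
  also have "\<dots> = (real m - real j) * krawtchouk m d {..<Suc j}"
    using assms by (simp add: card_Diff_subset of_nat_diff)
  finally have 1: "(\<Sum>i\<in>{..<m} - {..<j}. krawtchouk m d (insert i {..<j}))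
      = (real m - real j) * krawtchouk m d {..<Suc j}" .
  have "(\<Sum>i<j. krawtchouk m d ({..<j} - {i})) = (\<Sum>i<j. krawtchouk m d {..<j - 1})"
    using assms by (intro sum.cong krawtchouk_cong_card) auto
  then have 2: "(\<Sum>i<j. krawtchouk m d ({..<j} - {i})) = real j * krawtchouk m d {..<j - 1}" by simp
  show ?thesis using krawtchouk_rec[of "{..<j}" m d] assms 1 2 by simp
qed

text \<open>The characters of \<open>S\<close> and of its complement multiply to the character of
  all coordinates, which is \<open>(-1) ^ d = 1\<close> on sets of size \<open>d\<close>; being
  signs, the two are equal.\<close>

lemma krawtchouk_compl:
  assumes "S \<subseteq> {..<m}" "even d"
  shows "krawtchouk m d ({..<m} - S) = krawtchouk m d S"
  unfolding krawtchouk_def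
proof (intro sum.cong refl)
  fix y assume y: "y \<in> {y. y \<subseteq> {..<m} \<and> card y = d}"
  have "cube_char {..<m} y = (\<Prod>i\<in>y. - 1)"
  proof -
    have "cube_char {..<m} y = (\<Prod>i<m. if i \<in> y then -1 else 1)"
      unfolding cube_char_def cube_sign_def ..
    also have "\<dots> = (\<Prod>i\<in>{..<m} \<inter> y. - 1)" by (subst prod.inter_restrict) auto
    also have "{..<m} \<inter> y = y" using y by auto
    finally show ?thesis .
  qed
  also have "\<dots> = 1" using y assms by simp
  also have "cube_char {..<m} y = cube_char ({..<m} - S) y * cube_char S y"
    unfolding cube_char_def using assms by (intro prod.subset_diff) auto
  finally have "cube_char ({..<m} - S) y * cube_char S y = 1" .
  moreover have "cube_char S y = 1 \<or> cube_char S y = -1" for S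
    unfolding cube_char_def by (induction S rule: infinite_finite_induct) (auto simp: cube_sign_def)
  ultimately show "cube_char ({..<m} - S) y = cube_char S y" by (metis mult.right_neutral mult_minus1_right neg_eq_iff_add_eq_0)
qed

lemma krawtchouk_empty: "krawtchouk m d {} = real (m choose d)"
  using n_subsets[of "{..<m}" d] by (simp add: krawtchouk_def cube_char_def)

text \<open>
  The recurrence forces positivity as long as \<open>4 L\<^sup>2 j \<le> m\<close>; afterwards the triangle inequality
  gives geometric decay up to \<open>j = m/4\<close>, and between \<open>m/4\<close> and \<open>m/2\<close> the growth per step is
  at most \<open>5/4\<close>, which does not use up the decay because \<open>18/25 * 5/4 = 9/10\<close>.
\<close>
lemma recurrence_lower_bound:
  fixes \<kappa> :: "nat \<Rightarrow> real"
  assumes L: "8 \<le> L" and u: "1 \<le> u" and m: "m = 4 * L\<^sup>2 * u"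
    and k0: "\<kappa> 0 = 1"
    and rec: "\<And>j. j < m \<Longrightarrow> (real m - real j) * \<kappa> (Suc j) + real j * \<kappa> (j - 1) = (real m / real L) * \<kappa> j"
    and j: "2 * j \<le> m"
  shows "- ((9/10) ^ u) \<le> \<kappa> j"
proof -
  define Q where "Q = L\<^sup>2 * u"
  have mQ: "m = 4 * Q" using m by (simp add: Q_def)
  have L2: "1 \<le> L\<^sup>2" using L by (simp add: power2_eq_square)
  have uQ: "u \<le> Q" unfolding Q_def using L2 u by simp
  have Q1: "1 \<le> Q" using uQ u by linarith
  have L0: "0 < real L" using L by simp
  have Lm: "real m / real L \<le> real m / 8" using L by (intro divide_left_mono) auto
  \<comment> \<open>The recurrence with the triangle inequality: two consecutive values of size at
    most \<open>M\<close> bound the next one, with \<open>B\<close> dominating the ratio of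
    coefficients.\<close>
  have step: "\<bar>\<kappa> (Suc j)\<bar> \<le> B * M"
    if "\<bar>\<kappa> j\<bar> \<le> M" "\<bar>\<kappa> (j - 1)\<bar> \<le> M" "j < m" "real m / 8 + real j \<le> B * (real m - real j)" for j M B
  proof -
    have M0: "0 \<le> M" using that(1) by linarith
    have "(real m - real j) * \<bar>\<kappa> (Suc j)\<bar> = \<bar>(real m / real L) * \<kappa> j - real j * \<kappa> (j - 1)\<bar>"
      using rec[OF that(3)] that(3) by (simp add: abs_mult[symmetric] flip: abs_of_nonneg)
         (metis abs_mult abs_of_nonneg add_diff_cancel_right' diff_ge_0_iff_ge less_imp_le of_nat_le_iff)
    also have "\<dots> \<le> (real m / real L) * \<bar>\<kappa> j\<bar> + real j * \<bar>\<kappa> (j - 1)\<bar>"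
      by (rule order_trans[OF abs_triangle_ineq4]) (simp add: abs_mult)
    also have "\<dots> \<le> (real m / 8) * M + real j * M"
      using that Lm by (intro add_mono mult_mono) auto
    also have "\<dots> = (real m / 8 + real j) * M" by (simp add: algebra_simps)
    also have "\<dots> \<le> B * (real m - real j) * M" using that M0 by (intro mult_right_mono) auto
    finally have "(real m - real j) * \<bar>\<kappa> (Suc j)\<bar> \<le> (real m - real j) * (B * M)"
      by (simp add: algebra_simps)
    then show ?thesis using that(3) by simp
  qed
  \<comment> \<open>For \<open>j \<le> Q = m/4\<close> the size halves over two steps, so
    \<open>q\<close> must satisfy \<open>1/2 \<le> q\<^sup>2\<close>; 18/25 does so,
    narrowly.\<close>
  define q where "q = (18/25 :: real)"
  have phase1: "\<bar>\<kappa> j\<bar> \<le> q ^ j \<and> \<bar>\<kappa> (Suc j)\<bar> \<le> q ^ Suc j" if "j \<le> Q" for j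
    using that
  proof (induction j)
    case 0
    have "real m * \<kappa> 1 = real m / real L" using rec[of 0] k0 mQ Q1 by simp
    then have "real m * \<kappa> 1 = real m * (1 / real L)" by simp
    then have "\<kappa> 1 = 1 / real L" using mQ Q1 by (subst (asm) mult_left_cancel) auto
    moreover have "1 / real L \<le> 1 / 8" using L by (intro divide_left_mono) auto
    ultimately show ?case using k0 by (simp add: q_def)
  next
    case (Suc j)
    have "\<bar>\<kappa> (Suc (Suc j))\<bar> \<le> (1/2) * q ^ j"
    proof (rule step)
      show "\<bar>\<kappa> (Suc j)\<bar> \<le> q ^ j" using Suc by (auto intro: order_trans simp: q_def)
      show "\<bar>\<kappa> (Suc j - 1)\<bar> \<le> q ^ j" using Suc by simp
      show "Suc j < m" using Suc.prems mQ Q1 by linarith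
      show "real m / 8 + real (Suc j) \<le> 1 / 2 * (real m - real (Suc j))"
        using Suc.prems mQ by (simp add: field_simps)
    qed
    also have "\<dots> \<le> q\<^sup>2 * q ^ j" by (intro mult_right_mono) (auto simp: q_def power2_eq_square)
    finally show ?case using Suc by (simp add: power2_eq_square mult.assoc)
  qed
  \<comment> \<open>The condition of \<open>step\<close> with \<open>B = 5/4\<close> amounts to an
    index of at most \<open>m/2\<close>, where equality is reached.\<close>
  have phase2: "\<bar>\<kappa> (Q + i)\<bar> \<le> q ^ Q * (5/4) ^ i \<and> \<bar>\<kappa> (Suc (Q + i))\<bar> \<le> q ^ Q * (5/4) ^ Suc i"
    if "i < Q" for i
    using that
  proof (induction i)
    case 0
    have "q ^ Suc Q \<le> q ^ Q * (5/4)" by (simp add: q_def)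
    then show ?case using phase1[of Q] by auto
  next
    case (Suc i)
    have "\<bar>\<kappa> (Suc (Suc (Q + i)))\<bar> \<le> (5/4) * (q ^ Q * (5/4) ^ Suc i)"
    proof (rule step)
      show "\<bar>\<kappa> (Suc (Q + i))\<bar> \<le> q ^ Q * (5/4) ^ Suc i" using Suc by simp
      have "q ^ Q * (5/4) ^ i \<le> q ^ Q * (5/4) ^ Suc i" by (simp add: q_def)
      then show "\<bar>\<kappa> (Suc (Q + i) - 1)\<bar> \<le> q ^ Q * (5/4) ^ Suc i" using Suc by simp
      show "Suc (Q + i) < m" using Suc.prems mQ Q1 by linarith
      show "real m / 8 + real (Suc (Q + i)) \<le> 5/4 * (real m - real (Suc (Q + i)))"
        using Suc.prems mQ by (simp add: field_simps)
    qed
    then show ?case using Suc by (simp add: mult_ac)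
  qed
  have "- ((9/10) ^ u) \<le> \<kappa> j \<or> \<bar>\<kappa> j\<bar> \<le> (9/10) ^ u"
  proof (cases "j \<le> u")
    case True
    \<comment> \<open>Carrying the ratio bound along keeps the induction going: for indices up to
      \<open>u\<close> the subtracted term of the recurrence is at most
      \<open>2 * L * u = m / (2 * L)\<close> times the current value, half of the right-hand side,
      so the other half survives.\<close>
    have "0 < \<kappa> j \<and> \<kappa> j \<le> 2 * real L * \<kappa> (Suc j)" if "j \<le> u" for j
      using that
    proof (induction j)
      case 0
      have "real m * \<kappa> 1 = real m / real L" using rec[of 0] k0 mQ Q1 by simp
      then have "real m * \<kappa> 1 = real m * (1 / real L)" by simp
      then have "\<kappa> 1 = 1 / real L" using mQ Q1 by (subst (asm) mult_left_cancel) auto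
      then show ?case using k0 L by simp
    next
      case (Suc j)
      then have IH: "0 < \<kappa> j" "\<kappa> j \<le> 2 * real L * \<kappa> (Suc j)" by auto
      have "0 < 2 * real L * \<kappa> (Suc j)" using IH by linarith
      then have pos: "0 < \<kappa> (Suc j)" using L0 by (simp add: zero_less_mult_iff)
      have lt: "Suc j < m" using Suc.prems uQ mQ Q1 by linarith
      have "real (Suc j) * \<kappa> j \<le> real u * (2 * real L * \<kappa> (Suc j))"
        using Suc.prems IH by (intro mult_mono) auto
      also have "\<dots> = (real m / (2 * real L)) * \<kappa> (Suc j)"
        using L0 unfolding m by (simp add: power2_eq_square field_simps)
      finally have le: "real (Suc j) * \<kappa> j \<le> (real m / (2 * real L)) * \<kappa> (Suc j)" .
      have "(real m / (2 * real L)) * \<kappa> (Suc j) \<le> (real m - real (Suc j)) * \<kappa> (Suc (Suc j))"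
      proof -
        have "(real m / real L) * \<kappa> (Suc j) = 2 * ((real m / (2 * real L)) * \<kappa> (Suc j))" by simp
        moreover have "(real m - real (Suc j)) * \<kappa> (Suc (Suc j)) + real (Suc j) * \<kappa> j
            = (real m / real L) * \<kappa> (Suc j)" using rec[OF lt] by simp
        ultimately show ?thesis using le by argo
      qed
      moreover have m0: "0 < real m" using mQ Q1 by simp
      ultimately have a: "0 < (real m - real (Suc j)) * \<kappa> (Suc (Suc j))"
        using pos L0 by (smt (verit) divide_pos_pos mult_pos_pos)
      then have pos2: "0 < \<kappa> (Suc (Suc j))" using lt by (simp add: zero_less_mult_iff)
      have "(real m / (2 * real L)) * \<kappa> (Suc j) \<le> real m * \<kappa> (Suc (Suc j))"
        using \<open>(real m / (2 * real L)) * \<kappa> (Suc j) \<le> (real m - real (Suc j)) * \<kappa> (Suc (Suc j))\<close> pos2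
        by (smt (verit) mult_right_mono of_nat_0_le_iff)
      then have "\<kappa> (Suc j) \<le> 2 * real L * \<kappa> (Suc (Suc j))"
        using m0 L0 by (simp add: field_simps)
      then show ?case using pos by simp
    qed
    then have "0 < \<kappa> j" using True by blast
    moreover have "0 \<le> (9/10 :: real) ^ u" by simp
    ultimately show ?thesis by linarith
  next
    case False
    show ?thesis
    proof (cases "j \<le> Q")
      case True
      have "\<bar>\<kappa> j\<bar> \<le> q ^ j" using phase1[OF True] by simp
      also have "\<dots> \<le> (9/10) ^ j" by (intro power_mono) (auto simp: q_def)
      also have "\<dots> \<le> (9/10) ^ u" using False by (intro power_decreasing) auto
      finally show ?thesis by simp
    next
      case jQ: False
      define i where "i = j - Q - 1"
      have i: "j = Suc (Q + i)" "i < Q" "Suc i \<le> Q" using jQ j mQ unfolding i_def by auto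
      have "\<bar>\<kappa> j\<bar> \<le> q ^ Q * (5/4) ^ Suc i" using phase2[OF i(2)] i(1) by simp
      also have "\<dots> \<le> q ^ Q * (5/4) ^ Q" using i by (intro mult_left_mono power_increasing) (auto simp: q_def)
      also have "\<dots> = (9/10) ^ Q" by (simp add: q_def flip: power_mult_distrib)
      also have "\<dots> \<le> (9/10) ^ u" using uQ by (intro power_decreasing) auto
      finally show ?thesis by simp
    qed
  qed
  then show ?thesis by linarith
qed

lemma half_weight_le: "2 * (L - 1) * L * u \<le> 4 * L\<^sup>2 * (u::nat)"
proof -
  have "(L - 1) * L * u \<le> L * L * u" by (intro mult_le_mono) auto
  then have "2 * ((L - 1) * L * u) \<le> 4 * (L * L * u)" by linarith
  then show ?thesis by (simp only: power2_eq_square mult.assoc)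
qed

text \<open>The choice of \<open>m\<close> and \<open>d\<close> gives
  \<open>m - 2 * d = m / L\<close>, so the values divided by the degree obey the recurrence of
  \<open>recurrence_lower_bound\<close>. Sizes above \<open>m/2\<close> are reflected to the
  complement, as \<open>d\<close> is even.\<close>

lemma krawtchouk_ge:
  assumes L: "8 \<le> L" and u: "1 \<le> u" and m: "m = 4 * L\<^sup>2 * u" and d: "d = 2 * (L - 1) * L * u"
    and S: "S \<subseteq> {..<m}"
  shows "- ((9/10) ^ u) * real (m choose d) \<le> krawtchouk m d S"
proof -
  have dm: "d \<le> m" unfolding d m by (rule half_weight_le)
  have C: "0 < real (m choose d)" using dm by simp
  define \<kappa> where "\<kappa> j = krawtchouk m d {..<j} / real (m choose d)" for j
  have md: "real m - 2 * real d = real m / real L"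
    using L unfolding m d by (simp add: of_nat_diff power2_eq_square field_simps)
  have rec: "(real m - real j) * \<kappa> (Suc j) + real j * \<kappa> (j - 1) = (real m / real L) * \<kappa> j" if "j < m" for j
    using krawtchouk_rec_interval[OF that, of d] C unfolding \<kappa>_def md by (simp add: field_simps)
  have main: "- ((9/10) ^ u) * real (m choose d) \<le> krawtchouk m d T" if T: "T \<subseteq> {..<m}" "2 * card T \<le> m" for T
  proof -
    have "- ((9/10) ^ u) \<le> \<kappa> (card T)"
      using recurrence_lower_bound[OF L u m _ rec that(2)] C by (simp add: \<kappa>_def krawtchouk_empty)
    moreover have "card T \<le> m" using T card_mono[of "{..<m}" T] by simp
    then have "krawtchouk m d T = krawtchouk m d {..<card T}"
      using T by (intro krawtchouk_cong_card) auto
    ultimately show ?thesis using C by (simp add: \<kappa>_def field_simps)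
  qed
  have ed: "even d" unfolding d by simp
  have fS: "finite S" using S finite_subset by auto
  show ?thesis
  proof (cases "2 * card S \<le> m")
    case True
    then show ?thesis using main S by blast
  next
    case False
    then have "2 * card ({..<m} - S) \<le> m" using S fS by (simp add: card_Diff_subset)
    then show ?thesis using main[of "{..<m} - S"] krawtchouk_compl[OF S ed] by simp
  qed
qed

section \<open>Fourier analysis of kernels on the cube\<close>

text \<open>The sum over \<open>S\<close> factors over the coordinates into terms 1 plus a sign; a
  factor vanishes exactly where \<open>i\<close> lies in an odd number of the three sets.\<close>

lemma sum_cube_char:
  assumes "x \<subseteq> {..<m}" "y \<subseteq> {..<m}" "z \<subseteq> {..<m}"
  shows "(\<Sum>S\<in>Pow {..<m}. cube_char S x * cube_char S y * cube_char S z)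
    = (if z = sym_diff x y then 2 ^ m else 0)"
proof -
  let ?g = "\<lambda>i. cube_sign x i * cube_sign y i * cube_sign z i"
  have "(\<Sum>S\<in>Pow {..<m}. cube_char S x * cube_char S y * cube_char S z) = (\<Sum>S\<in>Pow {..<m}. (\<Prod>i\<in>S. ?g i) * (\<Prod>i\<in>{..<m} - S. 1))"
    unfolding cube_char_def by (simp add: prod.distrib)
  also have "\<dots> = (\<Prod>i<m. ?g i + 1)" by (subst prod_add) auto
  also have "\<dots> = (if z = sym_diff x y then 2 ^ m else 0)"
  proof (cases "z = sym_diff x y")
    case True
    then have "(\<Prod>i<m. ?g i + 1) = (\<Prod>i<m. 2)" by (intro prod.cong) (auto simp: cube_sign_def)
    then show ?thesis using True by simp
  next
    case False
    then obtain i where "i \<in> sym_diff z (sym_diff x y)" by blast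
    then have "i < m" "?g i + 1 = 0" using assms by (auto simp: cube_sign_def)
    then have "(\<Prod>i<m. ?g i + 1) = 0" by (intro prod_zero) auto
    then show ?thesis using False by simp
  qed
  finally show ?thesis .
qed

lemma card_sym_diff_sphere:
  assumes "x \<subseteq> {..<m}"
  shows "card {y \<in> Pow {..<m}. card (sym_diff x y) = d} = m choose d"
proof -
  have "bij_betw (sym_diff x) {y \<in> Pow {..<m}. card (sym_diff x y) = d} {z. z \<subseteq> {..<m} \<and> card z = d}"
  proof (rule bij_betw_byWitness[where f' = "sym_diff x"])
    have e: "sym_diff x (sym_diff x y) = y" for y by auto
    show "\<forall>a\<in>{y \<in> Pow {..<m}. card (sym_diff x y) = d}. sym_diff x (sym_diff x a) = a"
      "\<forall>a\<in>{z. z \<subseteq> {..<m} \<and> card z = d}. sym_diff x (sym_diff x a) = a" using e by blast+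
    show "sym_diff x ` {y \<in> Pow {..<m}. card (sym_diff x y) = d} \<subseteq> {z. z \<subseteq> {..<m} \<and> card z = d}"
      using assms by auto
    show "sym_diff x ` {z. z \<subseteq> {..<m} \<and> card z = d} \<subseteq> {y \<in> Pow {..<m}. card (sym_diff x y) = d}"
      using assms e by auto
  qed
  then show ?thesis using n_subsets[of "{..<m}" d] by (simp add: bij_betw_same_card)
qed

text \<open>Evaluate the form at all characters. The values \<open>q S\<close> are nonnegative,
  their sum sees the diagonal, and their sum weighted by eigenvalues sees the pairs at distance
  \<open>d\<close>. Bounding each eigenvalue below by \<open>krawtchouk_ge\<close> compares the two
  sums.\<close>

lemma cube_kernel_bound:
  fixes G :: "nat set \<Rightarrow> nat set \<Rightarrow> real"
  assumes L: "8 \<le> L" and u: "1 \<le> u" and m: "m = 4 * L\<^sup>2 * u" and d: "d = 2 * (L - 1) * L * u"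
    and psd: "\<And>c. 0 \<le> (\<Sum>x\<in>Pow {..<m}. \<Sum>y\<in>Pow {..<m}. c x * G x y * c y)"
    and diag: "\<And>x. x \<in> Pow {..<m} \<Longrightarrow> G x x = a"
    and dist: "\<And>x y. x \<in> Pow {..<m} \<Longrightarrow> y \<in> Pow {..<m} \<Longrightarrow> card (sym_diff x y) = d \<Longrightarrow> G x y = b"
  shows "- ((9/10) ^ u) * a \<le> b"
proof -
  let ?P = "Pow {..<m}"
  let ?C = "real (m choose d)"
  let ?l = "(9/10 :: real) ^ u"
  have dm: "d \<le> m" unfolding d m by (rule half_weight_le)
  have C: "0 < ?C" using dm by simp
  have finP: "finite ?P" by simp
  define q where "q S = (\<Sum>x\<in>?P. \<Sum>y\<in>?P. cube_char S x * G x y * cube_char S y)" for S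
  have expand: "(\<Sum>S\<in>?P. g S * q S) = (\<Sum>x\<in>?P. \<Sum>y\<in>?P. G x y * (\<Sum>S\<in>?P. g S * (cube_char S x * cube_char S y)))" for g
  proof -
    have "(\<Sum>S\<in>?P. g S * q S) = (\<Sum>S\<in>?P. \<Sum>x\<in>?P. \<Sum>y\<in>?P. G x y * (g S * (cube_char S x * cube_char S y)))"
      unfolding q_def by (simp add: sum_distrib_left mult_ac)
    also have "\<dots> = (\<Sum>x\<in>?P. \<Sum>S\<in>?P. \<Sum>y\<in>?P. G x y * (g S * (cube_char S x * cube_char S y)))"
      by (rule sum.swap)
    also have "\<dots> = (\<Sum>x\<in>?P. \<Sum>y\<in>?P. \<Sum>S\<in>?P. G x y * (g S * (cube_char S x * cube_char S y)))"
      by (intro sum.cong refl sum.swap)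
    finally show ?thesis by (simp add: sum_distrib_left)
  qed
  \<comment> \<open>Orthogonality of the characters removes all pairs with
    \<open>x \<noteq> y\<close>.\<close>
  have "(\<Sum>S\<in>?P. 1 * q S) = (\<Sum>x\<in>?P. \<Sum>y\<in>?P. if x = y then 2 ^ m * a else 0)"
    unfolding expand
  proof (intro sum.cong refl)
    fix x y assume xy: "x \<in> ?P" "y \<in> ?P"
    have "(\<Sum>S\<in>?P. 1 * (cube_char S x * cube_char S y)) = (if {} = sym_diff x y then 2 ^ m else 0)"
      using sum_cube_char[of x m y "{}"] xy by (simp add: cube_char_def cube_sign_def)
    moreover have "{} = sym_diff x y \<longleftrightarrow> x = y" by auto
    ultimately show "G x y * (\<Sum>S\<in>?P. 1 * (cube_char S x * cube_char S y)) = (if x = y then 2 ^ m * a else 0)"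
      using diag xy by auto
  qed
  then have tr: "(\<Sum>S\<in>?P. q S) = 2 ^ m * 2 ^ m * a" by (simp add: card_Pow)
  \<comment> \<open>Expanding the eigenvalue as a sum over \<open>z\<close> leaves, for each pair,
    the single term \<open>z = sym_diff x y\<close>, if this has size \<open>d\<close>.\<close>
  have "(\<Sum>S\<in>?P. krawtchouk m d S * q S) = (\<Sum>x\<in>?P. \<Sum>y\<in>?P. if card (sym_diff x y) = d then 2 ^ m * b else 0)"
    unfolding expand
  proof (intro sum.cong refl)
    fix x y assume xy: "x \<in> ?P" "y \<in> ?P"
    let ?Y = "{y. y \<subseteq> {..<m} \<and> card y = d}"
    have "(\<Sum>S\<in>?P. krawtchouk m d S * (cube_char S x * cube_char S y))
        = (\<Sum>S\<in>?P. \<Sum>z\<in>?Y. cube_char S x * cube_char S y * cube_char S z)"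
      unfolding krawtchouk_def by (simp add: sum_distrib_left mult_ac)
    also have "\<dots> = (\<Sum>z\<in>?Y. \<Sum>S\<in>?P. cube_char S x * cube_char S y * cube_char S z)" by (rule sum.swap)
    also have "\<dots> = (\<Sum>z\<in>?Y. if z = sym_diff x y then 2 ^ m else 0)"
      using xy by (intro sum.cong refl sum_cube_char) auto
    also have "\<dots> = (if sym_diff x y \<in> ?Y then 2 ^ m else 0)" by simp
    also have "sym_diff x y \<in> ?Y \<longleftrightarrow> card (sym_diff x y) = d" using xy by auto
    finally show "G x y * (\<Sum>S\<in>?P. krawtchouk m d S * (cube_char S x * cube_char S y))
        = (if card (sym_diff x y) = d then 2 ^ m * b else 0)" using dist xy by auto
  qed
  also have "\<dots> = (\<Sum>x\<in>?P. ?C * (2 ^ m * b))"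
  proof (intro sum.cong refl)
    fix x assume x: "x \<in> ?P"
    have "(\<Sum>y\<in>?P. if card (sym_diff x y) = d then 2 ^ m * b else 0)
       = (\<Sum>y\<in>{y\<in>?P. card (sym_diff x y) = d}. 2 ^ m * b)"
      by (rule sum.inter_filter[symmetric]) simp
    then show "(\<Sum>y\<in>?P. if card (sym_diff x y) = d then 2 ^ m * b else 0) = ?C * (2 ^ m * b)"
      using card_sym_diff_sphere[of x m d] x by simp
  qed
  also have "\<dots> = 2 ^ m * 2 ^ m * ?C * b" by (simp add: card_Pow)
  finally have k: "(\<Sum>S\<in>?P. krawtchouk m d S * q S) = 2 ^ m * 2 ^ m * ?C * b" .
  have "(\<Sum>S\<in>?P. - ?l * ?C * q S) \<le> (\<Sum>S\<in>?P. krawtchouk m d S * q S)"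
    using psd krawtchouk_ge[OF L u m d] unfolding q_def
    by (intro sum_mono mult_right_mono) auto
  then have "- ?l * ?C * (2 ^ m * 2 ^ m * a) \<le> 2 ^ m * 2 ^ m * ?C * b"
    unfolding k using tr by (simp only: sum_distrib_left[symmetric])
  then have "(2 ^ m * 2 ^ m * ?C) * (- ?l * a) \<le> (2 ^ m * 2 ^ m * ?C) * b" by (simp add: mult_ac)
  moreover have "0 < 2 ^ m * 2 ^ m * ?C" using C by simp
  ultimately show ?thesis by (rule mult_left_le_imp_le)
qed

section \<open>Exponential bounds\<close>

lemma cube_sign_mult: "cube_sign x i * cube_sign y i = cube_sign (sym_diff x y) i"
  by (auto simp: cube_sign_def)

text \<open>\<open>cube_kernel_bound\<close> is applied to the kernel minus \<open>mu\<close>, still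
  positive semidefinite, with diagonal \<open>1 - mu\<close> and value \<open>b - mu\<close> on
  edges.\<close>

lemma (in psd_kernel) mu_le_cube_value:
  assumes L: "8 \<le> L" and u: "1 \<le> u" and m: "m = 4 * L\<^sup>2 * u" and d: "d = 2 * (L - 1) * L * u"
    and v: "\<And>x. x \<subseteq> {..<m} \<Longrightarrow> v x \<in> X"
    and dist: "\<And>x y. x \<subseteq> {..<m} \<Longrightarrow> y \<subseteq> {..<m} \<Longrightarrow> card (sym_diff x y) = d \<Longrightarrow> A (v x) (v y) = b"
  shows "mu \<le> b + (9/10) ^ u"
proof -
  have "- ((9/10) ^ u) * (1 - mu) \<le> b - mu"
  proof (rule cube_kernel_bound[OF L u m d])
    fix c :: "nat set \<Rightarrow> real"
    let ?P = "Pow {..<m}"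
    have "(\<Sum>x\<in>?P. \<Sum>y\<in>?P. c x * (A (v x) (v y) - mu) * c y)
        = (\<Sum>x\<in>?P. \<Sum>y\<in>?P. c x * A (v x) (v y) * c y) - (\<Sum>x\<in>?P. \<Sum>y\<in>?P. mu * (c x * c y))"
      by (simp add: sum_subtractf[symmetric] algebra_simps)
    also have "(\<Sum>x\<in>?P. \<Sum>y\<in>?P. mu * (c x * c y)) = mu * (sum c ?P)\<^sup>2"
      unfolding power2_eq_square sum_product by (simp add: sum_distrib_left)
    finally show "0 \<le> (\<Sum>x\<in>?P. \<Sum>y\<in>?P. c x * (A (v x) (v y) - mu) * c y)"
      using family_form_ge_mu[of ?P v c] v by auto
  next
    show "A (v x) (v x) - mu = 1 - mu" if "x \<in> Pow {..<m}" for x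
      using that v diag by auto
    show "A (v x) (v y) - mu = b - mu"
      if "x \<in> Pow {..<m}" "y \<in> Pow {..<m}" "card (sym_diff x y) = d" for x y
      using that dist by auto
  qed
  then have "mu \<le> b + (9/10) ^ u * (1 - mu)" by linarith
  also have "(9/10) ^ u * (1 - mu) \<le> (9/10) ^ u * 1"
    using mu_nonneg by (intro mult_left_mono) auto
  finally show ?thesis by simp
qed

lemma sphere_integral_le:
  assumes L: "8 \<le> L" and u: "1 \<le> u" and n: "4 * L\<^sup>2 * u < n"
    and t: "1 / real L \<le> t" "t < 1"
    and f: "continuous_on {-1..1} f" "sphere_positive_type n f" "f 1 = 1"
  shows "sphere_integral n f \<le> f t + (9/10) ^ u"
proof -
  define m where "m = 4 * L\<^sup>2 * u"
  define d where "d = 2 * (L - 1) * L * u"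
  have m0: "0 < m" using L u by (simp add: m_def)
  have n2: "2 \<le> n" using n m0 unfolding m_def by linarith
  have md: "real m - 2 * real d = real m / real L"
    using L unfolding m_def d_def by (simp add: of_nat_diff power2_eq_square field_simps)
  interpret K: psd_kernel "Rn_sphere n" "\<lambda>x y. f (Rn_inner n x y)"
    using n2 f by (intro sphere_psd_kernel) auto
  \<comment> \<open>The solution of \<open>r / L + (1 - r) = t\<close>; \<open>t \<ge> 1 / L\<close>
    makes it at most 1.\<close>
  define r where "r = (1 - t) / (1 - 1 / real L)"
  have L1: "1 / real L < 1" using L by simp
  have r: "0 \<le> r" "r \<le> 1" "r * (1 - 1 / real L) = 1 - t"
  proof -
    show "0 \<le> r" unfolding r_def using t L1 by (intro divide_nonneg_nonneg) auto
    show "r \<le> 1" unfolding r_def using t L1 by (subst divide_le_eq_1_pos) auto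
    show "r * (1 - 1 / real L) = 1 - t" unfolding r_def using L1 by (subst nonzero_eq_divide_eq[symmetric]) auto
  qed
  \<comment> \<open>The first \<open>m\<close> coordinates carry the cube at radius
    \<open>sqrt r\<close>, coordinate \<open>m\<close> makes the vector a unit vector, and the rest
    are zero.\<close>
  define v where "v x = (\<lambda>i\<in>{..<n}. if i < m then sqrt (r / real m) * cube_sign x i
    else if i = m then sqrt (1 - r) else 0)" for x
  have inner: "Rn_inner n (v x) (v y) = r / real m * (real m - 2 * real (card (sym_diff x y))) + (1 - r)"
    if "x \<subseteq> {..<m}" "y \<subseteq> {..<m}" for x y
  proof -
    have sub: "{..<Suc m} \<subseteq> {..<n}" using n by (auto simp: m_def)
    have "Rn_inner n (v x) (v y) = (\<Sum>i<Suc m. v x i * v y i)"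
      unfolding Rn_inner_def using sub by (intro sum.mono_neutral_right) (auto simp: v_def)
    also have "\<dots> = (\<Sum>i<m. v x i * v y i) + (1 - r)"
      using n r by (simp add: v_def m_def)
    also have "(\<Sum>i<m. v x i * v y i) = (\<Sum>i<m. r / real m * cube_sign (sym_diff x y) i)"
    proof (intro sum.cong refl)
      fix i assume "i \<in> {..<m}"
      then have "v x i * v y i = (sqrt (r / real m) * sqrt (r / real m)) * (cube_sign x i * cube_sign y i)"
        using sub by (auto simp: v_def simp del: real_sqrt_mult_self)
      then show "v x i * v y i = r / real m * cube_sign (sym_diff x y) i"
        using r by (simp only: cube_sign_mult) simp
    qed
    also have "\<dots> = r / real m * (real m - 2 * real (card (sym_diff x y)))"
      using that by (subst sum_distrib_left[symmetric], subst sum_cube_sign) auto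
    finally show ?thesis .
  qed
  have "K.mu \<le> f t + (9/10) ^ u"
  proof (rule K.mu_le_cube_value[OF L u m_def d_def, of v])
    fix x assume "x \<subseteq> {..<m}"
    then have "Rn_inner n (v x) (v x) = 1" using inner[of x x] m0 by simp
    then have "Rn_norm n (v x) = 1"
      using Rn_norm_sqr[of n "v x"] Rn_norm_nonneg[of n "v x"] by (simp add: power2_eq_1_iff)
    then show "v x \<in> Rn_sphere n" by (simp add: Rn_sphere_def Rn_def v_def)
  next
    fix x y assume xy: "x \<subseteq> {..<m}" "y \<subseteq> {..<m}" "card (sym_diff x y) = d"
    have "Rn_inner n (v x) (v y) = r / real L + (1 - r)"
      using inner[OF xy(1,2)] m0 unfolding xy(3) md by simp
    also have "\<dots> = t" using r(3) by (simp add: algebra_simps)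
    finally show "f (Rn_inner n (v x) (v y)) = f t" by simp
  qed
  then show ?thesis using sphere_integral_eq_mu[OF n2 f] by simp
qed

lemma mean_value_le:
  assumes u: "1 \<le> u" and n: "256 * u \<le> n"
    and f: "continuous_on (Rn n) f" "Rn_radial n f" "Rn_positive_type n f" "f (Rn_zero n) = 1"
    and b: "\<And>x. x \<in> Rn_sphere n \<Longrightarrow> f x \<le> b"
  shows "mean_value n f \<le> b + (9/10) ^ u"
proof -
  define m :: nat where "m = 4 * 8\<^sup>2 * u"
  define d :: nat where "d = 2 * (8 - 1) * 8 * u"
  have mn: "m \<le> n" using n by (simp add: m_def)
  have d0: "0 < d" using u by (simp add: d_def)
  interpret K: psd_kernel "Rn n" "\<lambda>x y. f (Rn_diff n x y)"
    using f by (intro Rn_psd_kernel)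
  \<comment> \<open>Each of the \<open>d\<close> differing coordinates contributes
    \<open>4 * r\<close> to the squared distance, so adjacent points are at distance 1.\<close>
  define r where "r = 1 / (4 * real d)"
  define v where "v x = (\<lambda>i\<in>{..<n}. if i < m then sqrt r * cube_sign x i else 0)" for x
  obtain e where e: "e \<in> Rn_sphere n" using Rn_sphere_nonempty[of n] u n by fastforce
  have "K.mu \<le> f e + (9/10) ^ u"
  proof (rule K.mu_le_cube_value[OF _ u m_def d_def, of v])
    show "v x \<in> Rn n" for x by (simp add: v_def Rn_def)
    fix x y assume xy: "x \<subseteq> {..<m}" "y \<subseteq> {..<m}" "card (sym_diff x y) = d"
    let ?z = "Rn_diff n (v x) (v y)"
    have "Rn_inner n ?z ?z = (\<Sum>i<m. ?z i * ?z i)"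
      unfolding Rn_inner_def using mn by (intro sum.mono_neutral_right) (auto simp: v_def Rn_diff_def)
    also have "\<dots> = (\<Sum>i<m. 2 * r * (1 - cube_sign (sym_diff x y) i))"
    proof (intro sum.cong refl)
      fix i assume i: "i \<in> {..<m}"
      have "?z i = sqrt r * (cube_sign x i - cube_sign y i)"
        using i mn by (simp add: Rn_diff_def v_def algebra_simps)
      then have "?z i * ?z i = (sqrt r * sqrt r) * ((cube_sign x i - cube_sign y i) * (cube_sign x i - cube_sign y i))"
        by simp
      also have "sqrt r * sqrt r = r" by (simp add: r_def)
      also have "(cube_sign x i - cube_sign y i) * (cube_sign x i - cube_sign y i) = 2 * (1 - cube_sign (sym_diff x y) i)"
        by (auto simp: cube_sign_def)
      finally show "?z i * ?z i = 2 * r * (1 - cube_sign (sym_diff x y) i)" by simp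
    qed
    also have "\<dots> = 2 * r * (real m - (real m - 2 * real d))"
      using xy by (subst sum_distrib_left[symmetric], subst sum_subtractf, subst sum_cube_sign) auto
    also have "\<dots> = 1" using d0 by (simp add: r_def)
    finally have "Rn_norm n ?z = Rn_norm n e"
      using Rn_norm_sqr[of n ?z] Rn_norm_nonneg[of n ?z] e by (simp add: power2_eq_1_iff Rn_sphere_def)
    then show "f ?z = f e" using f(2) e by (auto simp: Rn_radial_def Rn_sphere_def)
  qed simp
  then show ?thesis using mean_value_eq_mu[OF f(1,3,4)] b[OF e] by simp
qed

section \<open>Exponential decay in the dimension\<close>

text \<open>Take the \<open>D\<close>-th root of 9/10 as the base. Rounding \<open>n / D\<close> up
  to \<open>Suc u\<close> loses one factor 9/10, which the factor 2 absorbs.\<close>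

lemma floor_power_le:
  assumes "0 < D"
  shows "\<exists>c::real. 0 < c \<and> c < 1 \<and> (\<forall>n u. n \<le> D * Suc u \<longrightarrow> (9/10) ^ u \<le> 2 * c ^ n)"
proof (intro exI conjI allI impI)
  define c :: real where "c = root D (9/10)"
  show c: "0 < c" "c < 1" using assms by (simp_all add: c_def)
  fix n u assume "n \<le> D * Suc u"
  then have "c ^ (D * Suc u) \<le> c ^ n" using c by (intro power_decreasing) auto
  moreover have "c ^ (D * Suc u) = (9/10) ^ Suc u"
    using assms unfolding power_mult c_def by (subst real_root_pow_pos2) auto
  moreover have "0 \<le> c ^ n" using c by simp
  ultimately show "(9/10) ^ u \<le> 2 * c ^ n" unfolding power_Suc by linarith
qed

text \<open>An explicit constant replaces the o(1) term: this form is stable under index shifts and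
  under adding another exponential term, as the recursion in \<open>k\<close> requires.\<close>

definition exp_small :: "(nat \<Rightarrow> ereal) \<Rightarrow> bool" where
  "exp_small a \<longleftrightarrow> (\<exists>C c. 0 \<le> C \<and> 0 < c \<and> c < 1 \<and> (\<forall>\<^sub>F n in sequentially. a n \<le> ereal (C * c ^ n)))"

lemma exp_small_imp_exp_bound:
  assumes "exp_small a"
  shows "\<exists>c\<in>{0<..<1}. exp_bound a c"
proof -
  obtain C c where c: "0 \<le> C" "0 < c" "c < 1" and le: "\<forall>\<^sub>F n in sequentially. a n \<le> ereal (C * c ^ n)"
    using assms unfolding exp_small_def by auto
  \<comment> \<open>Any base strictly between \<open>c\<close> and 1 absorbs the constant
    \<open>C\<close> for large \<open>n\<close>, so the error sequence can be taken zero.\<close>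
  define c' where "c' = (1 + c) / 2"
  have c': "c < c'" "0 < c'" "c' < 1" using c by (auto simp: c'_def)
  have "(\<lambda>n. C * (c / c') ^ n) \<longlonglongrightarrow> C * 0"
    using c c' by (intro tendsto_mult tendsto_const LIMSEQ_realpow_zero) auto
  then have "\<forall>\<^sub>F n in sequentially. C * (c / c') ^ n < 1"
    by (rule order_tendstoD) simp
  with le have "\<forall>\<^sub>F n in sequentially. a n \<le> ereal ((c' + 0) ^ n)"
  proof eventually_elim
    case (elim n)
    have "C * c ^ n = C * (c / c') ^ n * c' ^ n" using c' by (simp add: power_divide)
    also have "\<dots> \<le> 1 * c' ^ n" using elim(2) c' by (intro mult_right_mono) auto
    finally show ?case using elim(1) by (simp add: order_trans)
  qed
  then have "exp_bound a c'" unfolding exp_bound_def by (intro exI[of _ "\<lambda>_. 0"]) auto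
  then show ?thesis using c' by auto
qed

text \<open>One step of the recursion: \<open>b\<close> is the constraint on \<open>f\<close>,
  \<open>s\<close> any nonnegative real bound for it, and the cube adds
  \<open>2 * c ^ n\<close>.\<close>

lemma exp_small_add:
  assumes b: "exp_small b" and c: "0 < c" "c < 1"
    and le: "\<forall>\<^sub>F n in sequentially. \<forall>s. 0 \<le> s \<longrightarrow> b n \<le> ereal s \<longrightarrow> a n \<le> ereal (s + 2 * c ^ n)"
  shows "exp_small a"
proof -
  obtain C c1 where c1: "0 \<le> C" "0 < c1" "c1 < 1" and bn: "\<forall>\<^sub>F n in sequentially. b n \<le> ereal (C * c1 ^ n)"
    using b unfolding exp_small_def by auto
  let ?c = "max c c1"
  have "\<forall>\<^sub>F n in sequentially. a n \<le> ereal ((C + 2) * ?c ^ n)"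
    using bn le
  proof eventually_elim
    case (elim n)
    have "a n \<le> ereal (C * c1 ^ n + 2 * c ^ n)" using elim c1 by simp
    also have "C * c1 ^ n + 2 * c ^ n \<le> C * ?c ^ n + 2 * ?c ^ n"
      using c c1 by (intro add_mono mult_left_mono power_mono) auto
    finally show ?case by (simp add: distrib_right)
  qed
  then show ?thesis unfolding exp_small_def using c c1
    by (intro exI[of _ "C + 2"] exI[of _ ?c]) auto
qed

lemma exp_small_zero: "exp_small (\<lambda>_. 0)"
  unfolding exp_small_def by (intro exI[of _ 0] exI[of _ "1/2"]) (auto simp: zero_ereal_def)

lemma exp_small_pred:
  assumes "exp_small a"
  shows "exp_small (\<lambda>n. a (n - 1))"
proof -
  obtain C c where c: "0 \<le> C" "0 < c" "c < 1" and le: "\<forall>\<^sub>F n in sequentially. a n \<le> ereal (C * c ^ n)"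
    using assms unfolding exp_small_def by auto
  have "\<forall>\<^sub>F n in sequentially. a (Suc n - 1) \<le> ereal (C / c * c ^ Suc n)"
    using le by eventually_elim (use c in simp)
  then have "\<forall>\<^sub>F n in sequentially. a (n - 1) \<le> ereal (C / c * c ^ n)"
    by (subst (asm) eventually_sequentially_Suc)
  then show ?thesis unfolding exp_small_def using c
    by (intro exI[of _ "C / c"] exI[of _ c]) auto
qed

text \<open>The base and the threshold for \<open>n\<close> depend on \<open>t\<close> alone; this
  uniformity in \<open>f\<close> and \<open>s\<close> allows passing to the supremum.\<close>

lemma sphere_integral_exp_le:
  assumes t: "0 < t" "t < 1"
  shows "\<exists>c::real. 0 < c \<and> c < 1 \<and> (\<forall>\<^sub>F n in sequentially. \<forall>f s. continuous_on {-1..1} f \<longrightarrow>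
    sphere_positive_type n f \<longrightarrow> f 1 = 1 \<longrightarrow> f t \<le> s \<longrightarrow> sphere_integral n f \<le> s + 2 * c ^ n)"
proof -
  obtain L0 :: nat where L0: "1 / t < real L0" using reals_Archimedean2 by blast
  define L where "L = max 8 L0"
  have L: "8 \<le> L" "1 / real L \<le> t"
  proof -
    have "1 / t < real L" using L0 by (simp add: L_def)
    then show "1 / real L \<le> t" using t by (simp add: field_simps L_def split: if_splits)
  qed (simp add: L_def)
  define D where "D = 4 * L\<^sup>2"
  have D: "0 < D" using L by (simp add: D_def)
  obtain c :: real where c: "0 < c" "c < 1" "\<And>n u. n \<le> D * Suc u \<Longrightarrow> (9/10) ^ u \<le> 2 * c ^ n"
    using floor_power_le[OF D] by blast
  have "sphere_integral n f \<le> s + 2 * c ^ n"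
    if n: "D < n" and f: "continuous_on {-1..1} f" "sphere_positive_type n f" "f 1 = 1" "f t \<le> s" for n f s
  proof -
    \<comment> \<open>The largest \<open>u\<close> with \<open>D * u < n\<close>; the strict
      inequality leaves room for the extra coordinate.\<close>
    define u where "u = (n - 1) div D"
    have u1: "1 \<le> u" using n D by (simp add: u_def div_greater_zero_iff Suc_le_eq)
    have u2: "D * u < n"
    proof -
      have "D * u \<le> n - 1" unfolding u_def by simp
      then show ?thesis using n by linarith
    qed
    have u3: "n \<le> D * Suc u"
      using dividend_less_times_div[OF D, of "n - 1"] n unfolding u_def by simp
    have "sphere_integral n f \<le> f t + (9/10) ^ u"
      using u2 f t by (intro sphere_integral_le[OF L(1) u1 _ L(2)]) (auto simp: D_def)
    then show ?thesis using c(3)[OF u3] f(4) by linarith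
  qed
  then have "\<forall>\<^sub>F n in sequentially. \<forall>f s. continuous_on {-1..1} f \<longrightarrow>
    sphere_positive_type n f \<longrightarrow> f 1 = 1 \<longrightarrow> f t \<le> s \<longrightarrow> sphere_integral n f \<le> s + 2 * c ^ n"
    by (intro eventually_mono[OF eventually_gt_at_top[of D]]) blast
  then show ?thesis using c(1,2) by blast
qed

text \<open>Induction with \<open>t\<close> arbitrary, since the constraint refers to
  \<open>t / (1 + t)\<close>, which again lies in (0,1), and to dimension \<open>n - 1\<close>,
  covered by \<open>exp_small_pred\<close>. In the base case the constraint is the zero
  sequence.\<close>

lemma exp_small_theta_sphere:
  assumes "0 < t" "t < 1"
  shows "exp_small (\<lambda>n. theta_sphere n (Suc (Suc k)) t)"
  using assms
proof (induction k arbitrary: t)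
  case 0
  obtain c :: real where c: "0 < c" "c < 1" and ev: "\<forall>\<^sub>F n in sequentially. \<forall>f s. continuous_on {-1..1} f \<longrightarrow>
    sphere_positive_type n f \<longrightarrow> f 1 = 1 \<longrightarrow> f t \<le> s \<longrightarrow> sphere_integral n f \<le> s + 2 * c ^ n"
    using sphere_integral_exp_le[OF 0] by blast
  from ev have "\<forall>\<^sub>F n in sequentially. \<forall>s. 0 \<le> s \<longrightarrow> 0 \<le> ereal s \<longrightarrow> theta_sphere n (Suc (Suc 0)) t \<le> ereal (s + 2 * c ^ n)"
    by eventually_elim (auto intro!: SUP_least)
  then show ?case by (rule exp_small_add[OF exp_small_zero c])
next
  case (Suc k)
  obtain c :: real where c: "0 < c" "c < 1" and ev: "\<forall>\<^sub>F n in sequentially. \<forall>f s. continuous_on {-1..1} f \<longrightarrow>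
    sphere_positive_type n f \<longrightarrow> f 1 = 1 \<longrightarrow> f t \<le> s \<longrightarrow> sphere_integral n f \<le> s + 2 * c ^ n"
    using sphere_integral_exp_le[OF Suc.prems] by blast
  have "exp_small (\<lambda>n. theta_sphere n (Suc (Suc k)) (t / (1 + t)))"
    using Suc.prems by (intro Suc.IH) auto
  then have IH: "exp_small (\<lambda>n. theta_sphere (n - 1) (Suc (Suc k)) (t / (1 + t)))"
    by (rule exp_small_pred)
  from ev have "\<forall>\<^sub>F n in sequentially. \<forall>s. 0 \<le> s \<longrightarrow> theta_sphere (n - 1) (Suc (Suc k)) (t / (1 + t)) \<le> ereal s
      \<longrightarrow> theta_sphere n (Suc (Suc (Suc k))) t \<le> ereal (s + 2 * c ^ n)"
  proof eventually_elim
    case (elim n)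
    show ?case
    proof (intro allI impI)
      fix s assume s: "theta_sphere (n - 1) (Suc (Suc k)) (t / (1 + t)) \<le> ereal s"
      show "theta_sphere n (Suc (Suc (Suc k))) t \<le> ereal (s + 2 * c ^ n)"
        unfolding theta_sphere.simps
      proof (rule SUP_least)
        fix f assume f: "f \<in> {f. continuous_on {-1..1} f \<and> sphere_positive_type n f \<and> f 1 = 1 \<and>
                  ereal (f t) \<le> theta_sphere (n - 1) (Suc (Suc k)) (t / (1 + t))}"
        then have "ereal (f t) \<le> ereal s" using s by (blast intro: order_trans)
        then have "f t \<le> s" by simp
        then show "ereal (sphere_integral n f) \<le> ereal (s + 2 * c ^ n)" using f elim by auto
      qed
    qed
  qed
  then show ?case by (rule exp_small_add[OF IH c])
qed

lemma mean_value_exp_le: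
  "\<exists>c::real. 0 < c \<and> c < 1 \<and> (\<forall>\<^sub>F n in sequentially. \<forall>f b. continuous_on (Rn n) f \<longrightarrow> Rn_radial n f \<longrightarrow>
    Rn_positive_type n f \<longrightarrow> f (Rn_zero n) = 1 \<longrightarrow> (\<forall>x\<in>Rn_sphere n. f x \<le> b) \<longrightarrow> mean_value n f \<le> b + 2 * c ^ n)"
proof -
  obtain c :: real where c: "0 < c" "c < 1" "\<And>n u. n \<le> 256 * Suc u \<Longrightarrow> (9/10) ^ u \<le> 2 * c ^ n"
    using floor_power_le[of 256] by auto
  have "mean_value n f \<le> b + 2 * c ^ n"
    if n: "256 \<le> n" and f: "continuous_on (Rn n) f" "Rn_radial n f" "Rn_positive_type n f" "f (Rn_zero n) = 1"
      "\<And>x. x \<in> Rn_sphere n \<Longrightarrow> f x \<le> b" for n f b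
  proof -
    have "mean_value n f \<le> b + (9/10) ^ (n div 256)"
      using n f by (intro mean_value_le) auto
    moreover have "n \<le> 256 * Suc (n div 256)"
      using dividend_less_times_div[of 256 n] by simp
    ultimately show ?thesis using c(3) by fastforce
  qed
  then have "\<forall>\<^sub>F n in sequentially. \<forall>f b. continuous_on (Rn n) f \<longrightarrow> Rn_radial n f \<longrightarrow>
    Rn_positive_type n f \<longrightarrow> f (Rn_zero n) = 1 \<longrightarrow> (\<forall>x\<in>Rn_sphere n. f x \<le> b) \<longrightarrow> mean_value n f \<le> b + 2 * c ^ n"
    by (intro eventually_mono[OF eventually_ge_at_top[of 256]]) blast
  then show ?thesis using c(1,2) by blast
qed

lemma exp_small_theta_Rn:
  assumes k: "2 \<le> k"
  shows "exp_small (\<lambda>n. theta_Rn n k)"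
proof -
  define b where "b n = (if k = 2 then 0 else theta_sphere n (k - 1) (1/2))" for n
  have b: "exp_small b"
  proof (cases "k = 2")
    case True
    then show ?thesis using exp_small_zero by (simp add: b_def[abs_def])
  next
    case False
    then obtain j where "k = Suc (Suc (Suc j))" using k
      by (metis add_2_eq_Suc le_Suc_ex not0_implies_Suc numeral_2_eq_2 add_0_right)
    then show ?thesis using exp_small_theta_sphere[of "1/2" j] False by (simp add: b_def[abs_def])
  qed
  obtain c :: real where c: "0 < c" "c < 1" and ev: "\<forall>\<^sub>F n in sequentially. \<forall>f b. continuous_on (Rn n) f \<longrightarrow> Rn_radial n f \<longrightarrow>
    Rn_positive_type n f \<longrightarrow> f (Rn_zero n) = 1 \<longrightarrow> (\<forall>x\<in>Rn_sphere n. f x \<le> b) \<longrightarrow> mean_value n f \<le> b + 2 * c ^ n"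
    using mean_value_exp_le by blast
  from ev have "\<forall>\<^sub>F n in sequentially. \<forall>s. 0 \<le> s \<longrightarrow> b n \<le> ereal s \<longrightarrow> theta_Rn n k \<le> ereal (s + 2 * c ^ n)"
  proof eventually_elim
    case (elim n)
    show ?case
    proof (intro allI impI)
      fix s assume s: "0 \<le> s" "b n \<le> ereal s"
      show "theta_Rn n k \<le> ereal (s + 2 * c ^ n)"
        unfolding theta_Rn_def
      proof (rule SUP_least)
        fix f assume f: "f \<in> {f. continuous_on (Rn n) f \<and> Rn_radial n f \<and> Rn_positive_type n f \<and> f (Rn_zero n) = 1 \<and>
                  (\<forall>x \<in> Rn_sphere n. if k = 2 then f x = 0 else ereal (f x) \<le> theta_sphere n (k - 1) (1 / 2))}"
        have "f x \<le> s" if x: "x \<in> Rn_sphere n" for x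
        proof (cases "k = 2")
          case False
          then have "ereal (f x) \<le> b n" using f x by (auto simp: b_def)
          then have "ereal (f x) \<le> ereal s" using s(2) by (rule order_trans)
          then show ?thesis by simp
        qed (use f x s in auto)
        then show "ereal (mean_value n f) \<le> ereal (s + 2 * c ^ n)" using f elim by simp
      qed
    qed
  qed
  then show ?thesis by (rule exp_small_add[OF b c])
qed

theorem theorem1p1:
  fixes k :: nat
  assumes "2 \<le> k"
  shows "(\<forall>t\<in>{0<..<1::real}. \<exists>c\<in>{0<..<1::real}. exp_bound (\<lambda>n. theta_sphere n k t) c) \<and>
         (\<exists>c\<in>{0<..<1::real}. exp_bound (\<lambda>n. theta_Rn n k) c)"
proof
  obtain j where j: "k = Suc (Suc j)" using assms by (metis add_2_eq_Suc le_Suc_ex)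
  show "\<forall>t\<in>{0<..<1::real}. \<exists>c\<in>{0<..<1::real}. exp_bound (\<lambda>n. theta_sphere n k t) c"
    using exp_small_imp_exp_bound[OF exp_small_theta_sphere] unfolding j by auto
  show "\<exists>c\<in>{0<..<1::real}. exp_bound (\<lambda>n. theta_Rn n k) c"
    by (rule exp_small_imp_exp_bound[OF exp_small_theta_Rn[OF assms]])
qed

end
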